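(* Let $\delta>\delta_{\mathrm{AMP}}:=\frac{64}{\pi^2}-4$ and $\sigma_w^2=0$ (noiseless case). Then for every $\alpha_0\in\mathbb{C}$ with $0<|\alpha_0|\le 1$ and every $\sigma_0^2\in[0,1]$, the state evolution sequences $\{\alpha_t\}_{t\ge1}$, $\{\sigma_t^2\}_{t\ge1}$ satisfy $$\lim_{t\to\infty}|\alpha_t|=1\qquad\text{and}\qquad \lim_{t\to\infty}\sigma_t^2=0.$$
   Context: Complex state evolution (SE). Fix $\delta>0$ and $\sigma_w^2\ge0$. For $\alpha\in\mathbb{C}$ and $\sigma^2\ge0$ with $(\alpha,\sigma^2)\neq(0,0)$, let $\theta_\alpha$ be the argument of $\alpha$ ($\theta_0:=0$) and define $$\psi_1(\alpha,\sigma^2)=e^{\mathrm{i}\theta_\alpha}\int_0^{\pi/2}\frac{|\alpha|\sin^2\theta}{(|\alpha|^2\sin^2\theta+\sigma^2)^{1/2}}\,d\theta,$$ $$\psi_2(\alpha,\sigma^2;\delta,\sigma_w^2)=\frac4\delta\Big(|\alpha|^2+\sigma^2+1-\int_0^{\pi/2}\frac{2|\alpha|^2\sin^2\theta+\sigma^2}{(|\alpha|^2\sin^2\theta+\sigma^2)^{1/2}}\,d\theta\Big)+4\sigma_w^2 .$$ Given $(\alpha_0,\sigma_0^2)\in\mathbb{C}\times\mathbb{R}_{\ge0}\setminus\{(0,0)\}$, the SE sequences are defined by $\alpha_{t+1}=\psi_1(\alpha_t,\sigma_t^2)$, $\sigma_{t+1}^2=\psi_2(\alpha_t,\sigma_t^2;\delta,\sigma_w^2)$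 for $t\ge0$. *)

theory Defs
  imports "HOL-Analysis.Analysis"
begin

text \<open>theta_alpha = Arg alpha (with Arg 0 = 0 in the library), so e^{i theta_alpha} = cis (Arg alpha).\<close>

definition psi1 :: "complex \<Rightarrow> real \<Rightarrow> complex" where
  "psi1 a s2 = cis (Arg a) *
     complex_of_real (integral {0..pi/2}
       (\<lambda>\<theta>. cmod a * (sin \<theta>)\<^sup>2 / sqrt ((cmod a)\<^sup>2 * (sin \<theta>)\<^sup>2 + s2)))"

definition psi2 :: "complex \<Rightarrow> real \<Rightarrow> real \<Rightarrow> real \<Rightarrow> real" where
  "psi2 a s2 \<delta> sw2 = 4 / \<delta> * ((cmod a)\<^sup>2 + s2 + 1 -
     integral {0..pi/2}
       (\<lambda>\<theta>. (2 * (cmod a)\<^sup>2 * (sin \<theta>)\<^sup>2 + s2) / sqrt ((cmod a)\<^sup>2 * (sin \<theta>)\<^sup>2 + s2)))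
     + 4 * sw2"

fun SE :: "real \<Rightarrow> real \<Rightarrow> complex \<Rightarrow> real \<Rightarrow> nat \<Rightarrow> complex \<times> real" where
  "SE \<delta> sw2 a0 s0 0 = (a0, s0)"
| "SE \<delta> sw2 a0 s0 (Suc t) =
     (let (a, s) = SE \<delta> sw2 a0 s0 t in (psi1 a s, psi2 a s \<delta> sw2))"

end

(* In the variables m = |alpha|^2 / (|alpha|^2 + sigma^2) and l = sqrt (|alpha|^2 + sigma^2) the state
   evolution becomes
     |alpha'| = sqrt m B(m),   sigma'^2 = (4 / delta) (l^2 + 1 - l T(m))
   with complete elliptic integrals B and T that satisfy T' = B / 2 and B' = (T - 2 B) / (2 m (1 - m)).
   The variance level (1 - m) B(m)^2 is the curve on which |alpha| is stationary.  The threshold enters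
   through one inequality in m alone, with equality at m = 0 and m = 1, which says that on this curve
   the variance strictly decreases when delta / 4 > 16 / pi^2 - 1.

   Small variances may increase again, so the region below the curve is not invariant by itself.  But
   the minimum of sigma'^2 over l bounds the next l from below by L(m), where
   L(m)^2 = m B(m)^2 + (4 / delta) (1 - T(m)^2 / 4), and above L(m) the next variance stays below the
   curve.  So the regions {m >= n, l >= L(n), sigma^2 <= (1 - n) B(n)^2} are forward invariant, two steps
   map each of them strictly inside itself, and a compactness argument lets n tend to 1. *)

theory Submission
  imports Defs
begin

section \<open>Complete elliptic integrals\<close>

text \<open>The constant 16 / pi^2 - 1 is the value of (B^2 + 1 - B T) / ((1 - m) B^2) at m = 0,
  where B = pi / 4 and T = pi / 2. Equality at both ends leaves no room for a crude estimate: one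
  lower bound for T is exact at m = 0, another at m = 1, and the interval is cut between them. The
  third integral C behind the derivatives diverges logarithmically at m = 1. It is removed by C <=
  (1 - m)^(-1/4) B, whose exponent comes from B / C = 1 - m / 4 + ... at m = 0; this bounds T by a
  multiple of B, and what remains is polynomial in e = (1 - m)^(1/4). On the stationary curve the
  coefficient 1 in front of (T / 2 - B)^2 would be enough. The inequality is proved with 9/4, and
  the surplus pays for the descent from l = B(m) to l = L(m). The strict inequalities come without a
  rate, hence a supremum argument over limit points at the end instead of a contraction
  estimate.\<close>

definition ellB :: "real \<Rightarrow> real" where
  "ellB m = integral {0..pi/2} (\<lambda>\<theta>. (sin \<theta>)\<^sup>2 / sqrt (1 - m * (cos \<theta>)\<^sup>2))"

text \<open>In terms of Legendre's K and E at parameter m this is (K - E) / m, the companion of B =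
  (E - (1 - m) K) / m. The integral diverges at m = 1, so all facts about it assume m < 1.\<close>

definition ellC :: "real \<Rightarrow> real" where
  "ellC m = integral {0..pi/2} (\<lambda>\<theta>. (cos \<theta>)\<^sup>2 / sqrt (1 - m * (cos \<theta>)\<^sup>2))"

text \<open>This is E + m B = 2 E - (1 - m) K, in a form that stays meaningful at m = 1.\<close>

definition ellT :: "real \<Rightarrow> real" where
  "ellT m = integral {0..pi/2} (\<lambda>\<theta>. sqrt (1 - m * (cos \<theta>)\<^sup>2)) + m * ellB m"

lemma mult_cos_sq_le: "0 \<le> m \<Longrightarrow> m * (cos \<theta>)\<^sup>2 \<le> (m::real)"
  by (rule mult_left_le) (simp_all add: cos_squared_eq)

lemma mult_cos_sq_less_1: "0 \<le> m \<Longrightarrow> m < 1 \<Longrightarrow> m * (cos \<theta>)\<^sup>2 < (1::real)"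
  using mult_cos_sq_le[of m \<theta>] by linarith

lemma mult_cos_sq_le_1: "0 \<le> m \<Longrightarrow> m \<le> 1 \<Longrightarrow> m * (cos \<theta>)\<^sup>2 \<le> (1::real)"
  using mult_cos_sq_le[of m \<theta>] by linarith

lemma sin_sq_le_denom: "m \<le> 1 \<Longrightarrow> (sin \<theta>)\<^sup>2 \<le> 1 - m * (cos \<theta>)\<^sup>2" for m :: real
  using mult_right_mono[of m 1 "(cos \<theta>)\<^sup>2"] by (simp add: sin_squared_eq)

text \<open>The root is at least sin theta. This bound, uniform in m, replaces the quotient rule for
  limits at the corner m = 1, theta = 0.\<close>

lemma ellB_integrand_le_sin:
  assumes "m \<le> 1" "0 \<le> \<theta>" "\<theta> \<le> pi / 2"
  shows "(sin \<theta>)\<^sup>2 / sqrt (1 - m * (cos \<theta>)\<^sup>2) \<le> sin \<theta>"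
proof (cases "sin \<theta> = 0")
  case False
  have s: "0 < sin \<theta>" using False assms sin_ge_zero[of \<theta>] by linarith
  have "sin \<theta> \<le> sqrt (1 - m * (cos \<theta>)\<^sup>2)"
    using sin_sq_le_denom[OF assms(1)] real_le_rsqrt by blast
  then have "(sin \<theta>)\<^sup>2 / sqrt (1 - m * (cos \<theta>)\<^sup>2) \<le> (sin \<theta>)\<^sup>2 / sin \<theta>"
    using s by (intro divide_left_mono mult_pos_pos) (linarith | simp)+
  then show ?thesis using s by (simp add: power2_eq_square)
qed simp

text \<open>At \<open>m = 1\<close>, \<open>\<theta> = 0\<close> the integrand is \<open>0 / 0 = 0\<close>, which happens to be its limit.\<close>

lemma continuous_on_ellB_integrand:
  "continuous_on ({0..1} \<times> {0..pi/2}) (\<lambda>(m, \<theta>). (sin \<theta>)\<^sup>2 / sqrt (1 - m * (cos \<theta>)\<^sup>2))"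
  (is "continuous_on ?S ?f")
proof (rule continuous_on_eq_continuous_within[THEN iffD2, rule_format])
  fix x assume x: "x \<in> ?S"
  obtain m \<theta> where mt: "x = (m, \<theta>)" by (cases x)
  show "continuous (at x within ?S) ?f"
  proof (cases "m * (cos \<theta>)\<^sup>2 = 1")
    case False
    then show ?thesis unfolding mt split_beta by (intro continuous_intros) auto
  next
    case True
    have "(sin \<theta>)\<^sup>2 \<le> 0" using sin_sq_le_denom[of m \<theta>] x True mt by auto
    then have s0: "sin \<theta> = 0" by simp
    have f0: "?f x = 0" using s0 mt by simp
    have lim: "((\<lambda>y. sin (snd y)) \<longlongrightarrow> sin (snd x)) (at x within ?S)"
      by (intro tendsto_intros)
    have "((\<lambda>y. ?f y) \<longlongrightarrow> 0) (at x within ?S)"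
    proof (rule tendsto_sandwich[of "\<lambda>_. 0" _ _ "\<lambda>y. sin (snd y)"])
      have in_S: "eventually (\<lambda>y. y \<in> ?S) (at x within ?S)"
        by (simp add: eventually_at_filter)
      show "\<forall>\<^sub>F y in at x within ?S. 0 \<le> ?f y"
        using in_S by eventually_elim (auto intro!: divide_nonneg_nonneg simp: mult_cos_sq_le_1)
      show "\<forall>\<^sub>F y in at x within ?S. ?f y \<le> sin (snd y)"
        using in_S by eventually_elim (auto intro!: ellB_integrand_le_sin)
      show "((\<lambda>y. sin (snd y)) \<longlongrightarrow> 0) (at x within ?S)"
        using lim s0 mt by simp
    qed simp
    then show ?thesis unfolding continuous_within f0 by simp
  qed
qed

lemma continuous_on_ellB: "continuous_on {0..1} ellB"
  unfolding ellB_def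
  using integral_continuous_on_param[of "{0..1::real}" 0 "pi/2"
      "\<lambda>m \<theta>. (sin \<theta>)\<^sup>2 / sqrt (1 - m * (cos \<theta>)\<^sup>2)"] continuous_on_ellB_integrand
  by (simp flip: interval_cbox)

lemma continuous_on_ellT: "continuous_on {0..1} ellT"
proof -
  have "continuous_on ({0..1} \<times> cbox 0 (pi/2)) (\<lambda>(m, \<theta>). sqrt (1 - m * (cos \<theta>)\<^sup>2))"
    unfolding split_beta by (intro continuous_intros)
  then have "continuous_on {0..1} (\<lambda>m. integral (cbox 0 (pi/2)) (\<lambda>\<theta>. sqrt (1 - m * (cos \<theta>)\<^sup>2)))"
    by (rule integral_continuous_on_param)
  then show ?thesis unfolding ellT_def
    by (intro continuous_intros continuous_on_ellB) (simp flip: interval_cbox)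
qed

lemma integrable_ellB:
  assumes "0 \<le> m" "m \<le> 1"
  shows "(\<lambda>\<theta>. (sin \<theta>)\<^sup>2 / sqrt (1 - m * (cos \<theta>)\<^sup>2)) integrable_on {0..pi/2}"
proof -
  have "continuous_on {0..pi/2} (\<lambda>\<theta>. case (m, \<theta>) of (m, \<theta>) \<Rightarrow> (sin \<theta>)\<^sup>2 / sqrt (1 - m * (cos \<theta>)\<^sup>2))"
    by (rule continuous_on_compose2[OF continuous_on_ellB_integrand])
      (use assms in \<open>auto intro!: continuous_intros\<close>)
  then show ?thesis by (intro integrable_continuous_real) simp
qed

lemma integrable_sqrt_denom:
  "(\<lambda>\<theta>. sqrt (1 - m * (cos \<theta>)\<^sup>2)) integrable_on {0..pi/2::real}"
  by (intro integrable_continuous_real continuous_intros)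

lemma integrable_ellC:
  assumes "0 \<le> m" "m < 1"
  shows "(\<lambda>\<theta>. (cos \<theta>)\<^sup>2 / sqrt (1 - m * (cos \<theta>)\<^sup>2)) integrable_on {0..pi/2::real}"
  using mult_cos_sq_less_1[OF assms]
  by (intro integrable_continuous_real continuous_intros) (metis less_irrefl diff_eq_eq add_0 real_sqrt_eq_zero_cancel_iff)

text \<open>Writing 1 - m cos^2 as sin^2 + (1 - m) cos^2 gives E = B + (1 - m) C.\<close>

lemma ellT_eq:
  assumes "0 \<le> m" "m < 1"
  shows "ellT m = (1 + m) * ellB m + (1 - m) * ellC m"
proof -
  have *: "sqrt (1 - m * (cos \<theta>)\<^sup>2) = (sin \<theta>)\<^sup>2 / sqrt (1 - m * (cos \<theta>)\<^sup>2)
     + (1 - m) * ((cos \<theta>)\<^sup>2 / sqrt (1 - m * (cos \<theta>)\<^sup>2))" for \<theta>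
  proof -
    have "sqrt (1 - m * (cos \<theta>)\<^sup>2) = (1 - m * (cos \<theta>)\<^sup>2) / sqrt (1 - m * (cos \<theta>)\<^sup>2)"
      using mult_cos_sq_less_1[OF assms, of \<theta>] by (simp add: real_div_sqrt)
    also have "\<dots> = ((sin \<theta>)\<^sup>2 + (1 - m) * (cos \<theta>)\<^sup>2) / sqrt (1 - m * (cos \<theta>)\<^sup>2)"
      by (simp add: sin_squared_eq algebra_simps)
    finally show ?thesis by (simp add: add_divide_distrib)
  qed
  have "integral {0..pi/2} (\<lambda>\<theta>. sqrt (1 - m * (cos \<theta>)\<^sup>2)) = ellB m + (1 - m) * ellC m"
    unfolding ellB_def ellC_def
    by (subst *, subst integral_add)
      (use assms integrable_ellB[of m] integrable_on_mult_right[OF integrable_ellC[OF assms]]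
        in \<open>simp_all only: integral_mult_right less_imp_le\<close>)
  then show ?thesis by (simp add: ellT_def algebra_simps)
qed

section \<open>Trigonometric moments, endpoint values and lower bounds for B\<close>

lemma integral_FTC:
  assumes "a \<le> b" "\<And>x. x \<in> {a..b} \<Longrightarrow> (F has_real_derivative f x) (at x)"
  shows "(f has_integral (F b - F a)) {a..b}"
  using assms
  by (intro fundamental_theorem_of_calculus)
    (auto intro: has_field_derivative_at_within simp: has_real_derivative_iff_has_vector_derivative[symmetric])

lemma has_integral_sin_sq: "((\<lambda>x. (sin x)\<^sup>2) has_integral pi/4) {0..pi/2}"
proof -
  have "((\<lambda>x. (sin x)\<^sup>2) has_integral ((\<lambda>x. (x - sin x * cos x)/2) (pi/2) - (\<lambda>x. (x - sin x * cos x)/2) 0)) {0..pi/2}"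
    by (rule integral_FTC) (auto intro!: derivative_eq_intros simp: power2_eq_square[symmetric] sin_squared_eq field_simps)
  then show ?thesis by simp
qed

lemma has_integral_cos_sq: "((\<lambda>x. (cos x)\<^sup>2) has_integral pi/4) {0..pi/2}"
proof -
  have "((\<lambda>x. (cos x)\<^sup>2) has_integral ((\<lambda>x. (x + sin x * cos x)/2) (pi/2) - (\<lambda>x. (x + sin x * cos x)/2) 0)) {0..pi/2}"
    by (rule integral_FTC) (auto intro!: derivative_eq_intros simp: power2_eq_square[symmetric] sin_squared_eq field_simps)
  then show ?thesis by simp
qed

lemma has_integral_sin_sq_cos_sq: "((\<lambda>x. (sin x)\<^sup>2 * (cos x)\<^sup>2) has_integral pi/16) {0..pi/2}"
proof -
  \<comment> \<open>\<open>?F\<close> comes from d(sin cos^3) = (cos^2 - 4 sin^2 cos^2) dx; the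
    identity below rewrites its derivative with u = cos^2 and v = sin^2.\<close>
  let ?F = "\<lambda>x::real. ((x + sin x * cos x)/2 - sin x * cos x ^ 3) / 4"
  have *: "((u - v + 1) / 2 - (u\<^sup>2 - 3 * v * u)) / 4 = v * u" if "v = 1 - u" for u v :: real
    unfolding that by (simp add: field_simps power2_eq_square)
  have "((\<lambda>x. (sin x)\<^sup>2 * (cos x)\<^sup>2) has_integral (?F (pi/2) - ?F 0)) {0..pi/2}"
  proof (rule integral_FTC)
    fix x :: real
    show "(?F has_real_derivative (sin x)\<^sup>2 * (cos x)\<^sup>2) (at x)"
      by (subst *[symmetric, OF sin_squared_eq])
        (auto intro!: derivative_eq_intros simp: field_simps eval_nat_numeral)
  qed simp
  then show ?thesis by simp
qed

lemma has_integral_sin_sq_cos_4: "((\<lambda>x. (sin x)\<^sup>2 * (cos x) ^ 4) has_integral pi/32) {0..pi/2}"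
proof -
  \<comment> \<open>Here d(sin cos^5) = (cos^4 - 6 sin^2 cos^4) dx, with cos^4 = cos^2 - sin^2
    cos^2.\<close>
  let ?F = "\<lambda>x::real. ((x + sin x * cos x)/2 - ((x + sin x * cos x)/2 - sin x * cos x ^ 3) / 4 - sin x * cos x ^ 5) / 6"
  have *: "((u - v + 1) / 2 - ((u - v + 1) / 2 - (u\<^sup>2 - 3 * v * u)) / 4 - (u ^ 3 - 5 * v * u\<^sup>2)) / 6 = v * u\<^sup>2"
    if "v = 1 - u" for u v :: real
    unfolding that by (simp add: field_simps power2_eq_square power3_eq_cube)
  have "((\<lambda>x. (sin x)\<^sup>2 * ((cos x)\<^sup>2)\<^sup>2) has_integral (?F (pi/2) - ?F 0)) {0..pi/2}"
  proof (rule integral_FTC)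
    fix x :: real
    show "(?F has_real_derivative (sin x)\<^sup>2 * ((cos x)\<^sup>2)\<^sup>2) (at x)"
      by (subst *[symmetric, OF sin_squared_eq])
        (auto intro!: derivative_eq_intros simp: field_simps eval_nat_numeral)
  qed simp
  then show ?thesis by simp
qed

lemma ellB_0: "ellB 0 = pi / 4"
  using has_integral_sin_sq by (simp add: ellB_def integral_unique)

lemma ellC_0: "ellC 0 = pi / 4"
  using has_integral_cos_sq by (simp add: ellC_def integral_unique)

lemma ellT_0: "ellT 0 = pi / 2"
  by (simp add: ellT_eq ellB_0 ellC_0)

lemma has_integral_sin_quarter: "(sin has_integral (1::real)) {0..pi/2}"
proof -
  have "(sin has_integral ((\<lambda>x. - cos x) (pi/2) - (\<lambda>x. - cos x) 0)) {0..pi/2::real}"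
    by (rule integral_FTC) (auto intro!: derivative_eq_intros)
  then show ?thesis by simp
qed

lemma ellB_1: "ellB 1 = 1"
proof -
  have "ellB 1 = integral {0..pi/2} sin"
    unfolding ellB_def
  proof (rule integral_cong)
    fix x :: real assume "x \<in> {0..pi/2}"
    then have "0 \<le> sin x" by (auto intro: sin_ge_zero)
    then show "(sin x)\<^sup>2 / sqrt (1 - 1 * (cos x)\<^sup>2) = sin x"
      by (simp only: mult_1 sin_squared_eq[symmetric] real_sqrt_abs) (simp add: power2_eq_square)
  qed
  then show ?thesis using has_integral_sin_quarter by (simp add: integral_unique)
qed

lemma ellT_1: "ellT 1 = 2"
proof -
  have "integral {0..pi/2} (\<lambda>\<theta>::real. sqrt (1 - 1 * (cos \<theta>)\<^sup>2)) = integral {0..pi/2} sin"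
  proof (rule integral_cong)
    fix x :: real assume "x \<in> {0..pi/2}"
    then have "0 \<le> sin x" by (auto intro: sin_ge_zero)
    then show "sqrt (1 - 1 * (cos x)\<^sup>2) = sin x"
      by (simp add: sin_squared_eq[symmetric])
  qed
  then show ?thesis using has_integral_sin_quarter ellB_1 by (simp add: ellT_def integral_unique)
qed

lemma ellB_mono:
  assumes "0 \<le> m" "m \<le> n" "n \<le> 1"
  shows "ellB m \<le> ellB n"
  unfolding ellB_def
proof (rule integral_le)
  fix x :: real assume "x \<in> {0..pi/2}"
  show "(sin x)\<^sup>2 / sqrt (1 - m * (cos x)\<^sup>2) \<le> (sin x)\<^sup>2 / sqrt (1 - n * (cos x)\<^sup>2)"
  proof (cases "sin x = 0")
    case False
    then have "0 < (sin x)\<^sup>2" by simp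
    then have "0 < 1 - n * (cos x)\<^sup>2" using sin_sq_le_denom[of n x] assms by linarith
    moreover have "m * (cos x)\<^sup>2 \<le> n * (cos x)\<^sup>2" using assms by (simp add: mult_right_mono)
    ultimately show ?thesis by (intro divide_left_mono mult_pos_pos) auto
  qed simp
qed (use assms in \<open>auto intro: integrable_ellB\<close>)

lemma ellB_le_1: "0 \<le> m \<Longrightarrow> m \<le> 1 \<Longrightarrow> ellB m \<le> 1"
  using ellB_mono[of m 1] ellB_1 by simp

lemma ellB_ge: "0 \<le> m \<Longrightarrow> m \<le> 1 \<Longrightarrow> pi/4 \<le> ellB m"
  using ellB_mono[of 0 m] ellB_0 by simp

lemma ellB_pos: "0 \<le> m \<Longrightarrow> m \<le> 1 \<Longrightarrow> 0 < ellB m"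
  using ellB_ge[of m] pi_gt_zero by linarith

text \<open>The second Taylor polynomial of (1 - y)^(-1/2); squaring turns the comparison into a
  polynomial identity.\<close>

lemma inverse_sqrt_ge:
  assumes "0 \<le> y" "y < (1::real)"
  shows "1 + y/2 + 3*y\<^sup>2/8 \<le> 1 / sqrt (1 - y)"
proof -
  have "(1 + y/2 + 3*y\<^sup>2/8)\<^sup>2 * (1 - y) = 1 - y^3 * (40 + 15 * y + 9 * y\<^sup>2) / 64"
    by (simp add: field_simps power2_eq_square power3_eq_cube)
  also have "\<dots> \<le> 1" using assms by simp
  finally have "(1 + y/2 + 3*y\<^sup>2/8)\<^sup>2 \<le> (1 / sqrt (1 - y))\<^sup>2"
    using assms by (simp add: power_divide field_simps)
  then show ?thesis using assms by (auto intro: power2_le_imp_le)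
qed

text \<open>The Taylor bound at y = m cos^2 is integrated against sin^2; the three moments above
  give the coefficients.\<close>

lemma ellB_ge_poly:
  assumes "0 \<le> m" "m < 1"
  shows "pi/4 * (1 + m/8 + 3*m\<^sup>2/64) \<le> ellB m"
proof -
  have "((\<lambda>x. (sin x)\<^sup>2 + m/2 * ((sin x)\<^sup>2 * (cos x)\<^sup>2) + 3*m\<^sup>2/8 * ((sin x)\<^sup>2 * (cos x)^4))
    has_integral (pi/4 + m/2 * (pi/16) + 3*m\<^sup>2/8 * (pi/32))) {0..pi/2}"
    by (intro has_integral_add has_integral_mult_right has_integral_sin_sq has_integral_sin_sq_cos_sq has_integral_sin_sq_cos_4)
  moreover have "((\<lambda>x. (sin x)\<^sup>2 / sqrt (1 - m * (cos x)\<^sup>2)) has_integral ellB m) {0..pi/2}"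
    unfolding ellB_def using integrable_ellB assms by (simp add: has_integral_integral)
  ultimately have "pi/4 + m/2 * (pi/16) + 3*m\<^sup>2/8 * (pi/32) \<le> ellB m"
  proof (rule has_integral_le)
    fix x :: real
    have "(sin x)\<^sup>2 * (1 + (m * (cos x)\<^sup>2)/2 + 3*(m * (cos x)\<^sup>2)\<^sup>2/8) \<le> (sin x)\<^sup>2 * (1 / sqrt (1 - m * (cos x)\<^sup>2))"
      using assms by (intro mult_left_mono inverse_sqrt_ge mult_cos_sq_less_1) auto
    then show "(sin x)\<^sup>2 + m/2 * ((sin x)\<^sup>2 * (cos x)\<^sup>2) + 3*m\<^sup>2/8 * ((sin x)\<^sup>2 * (cos x)^4)
      \<le> (sin x)\<^sup>2 / sqrt (1 - m * (cos x)\<^sup>2)"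
      by (simp add: algebra_simps power_mult_distrib flip: power_mult)
  qed
  then show ?thesis by (simp add: algebra_simps)
qed

section \<open>Derivatives with respect to the parameter\<close>

lemma has_integral_ellB:
  assumes "0 \<le> m" "m \<le> 1"
  shows "((\<lambda>\<theta>. (sin \<theta>)\<^sup>2 / sqrt (1 - m * (cos \<theta>)\<^sup>2)) has_integral ellB m) {0..pi/2}"
  unfolding ellB_def using integrable_ellB[OF assms] by (simp only: has_integral_integral)

lemma has_integral_ellC:
  assumes "0 \<le> m" "m < 1"
  shows "((\<lambda>\<theta>. (cos \<theta>)\<^sup>2 / sqrt (1 - m * (cos \<theta>)\<^sup>2)) has_integral ellC m) {0..pi/2}"
  unfolding ellC_def using integrable_ellC[OF assms] by (simp only: has_integral_integral)

text \<open>The integrand is the derivative of sin cos / sqrt (1 - m cos^2), which vanishes at both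
  ends. This relation expresses the integrals with a cubed root, produced by differentiating in m,
  through B and C.\<close>

lemma has_integral_total_derivative:
  assumes "0 \<le> m" "m < 1"
  shows "((\<lambda>\<theta>. ((cos \<theta>)\<^sup>2 - (sin \<theta>)\<^sup>2) / sqrt (1 - m * (cos \<theta>)\<^sup>2)
       - m * ((sin \<theta>)\<^sup>2 * (cos \<theta>)\<^sup>2 / sqrt (1 - m * (cos \<theta>)\<^sup>2) ^ 3)) has_integral 0) {0..pi/2}"
proof -
  let ?F = "\<lambda>\<theta>. sin \<theta> * cos \<theta> / sqrt (1 - m * (cos \<theta>)\<^sup>2)"
  let ?f = "\<lambda>\<theta>. ((cos \<theta>)\<^sup>2 - (sin \<theta>)\<^sup>2) / sqrt (1 - m * (cos \<theta>)\<^sup>2)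
       - m * ((sin \<theta>)\<^sup>2 * (cos \<theta>)\<^sup>2 / sqrt (1 - m * (cos \<theta>)\<^sup>2) ^ 3)"
  have "(?f has_integral (?F (pi/2) - ?F 0)) {0..pi/2}"
  proof (rule integral_FTC)
    fix x :: real
    define D where "D = sqrt (1 - m * (cos x)\<^sup>2)"
    have D: "0 < D" unfolding D_def using mult_cos_sq_less_1[OF assms] by simp
    have "((\<lambda>x. sqrt (1 - m * (cos x)\<^sup>2)) has_real_derivative (m * sin x * cos x / D)) (at x)"
      using mult_cos_sq_less_1[OF assms, of x] D
      by (auto intro!: derivative_eq_intros simp: D_def field_simps)
    moreover have "((\<lambda>x. sin x * cos x) has_real_derivative (cos x)\<^sup>2 - (sin x)\<^sup>2) (at x)"
      by (auto intro!: derivative_eq_intros simp: power2_eq_square)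
    ultimately have "(?F has_real_derivative
       (((cos x)\<^sup>2 - (sin x)\<^sup>2) * D - (sin x * cos x) * (m * sin x * cos x / D)) / (D * D)) (at x)"
      using D unfolding D_def by (intro DERIV_divide) auto
    also have "(((cos x)\<^sup>2 - (sin x)\<^sup>2) * D - (sin x * cos x) * (m * sin x * cos x / D)) / (D * D) = ?f x"
      using D unfolding D_def[symmetric] by (simp add: field_simps eval_nat_numeral)
    finally show "(?F has_real_derivative ?f x) (at x)" .
  qed simp
  then show ?thesis by simp
qed

lemma has_integral_ellB_deriv:
  assumes "0 < m" "m < 1"
  shows "((\<lambda>\<theta>. (sin \<theta>)\<^sup>2 * (cos \<theta>)\<^sup>2 / (2 * sqrt (1 - m * (cos \<theta>)\<^sup>2) ^ 3))
    has_integral (ellC m - ellB m) / (2 * m)) {0..pi/2}"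
proof -
  have "((\<lambda>\<theta>. ((cos \<theta>)\<^sup>2 / sqrt (1 - m * (cos \<theta>)\<^sup>2) - (sin \<theta>)\<^sup>2 / sqrt (1 - m * (cos \<theta>)\<^sup>2)
      - (((cos \<theta>)\<^sup>2 - (sin \<theta>)\<^sup>2) / sqrt (1 - m * (cos \<theta>)\<^sup>2)
       - m * ((sin \<theta>)\<^sup>2 * (cos \<theta>)\<^sup>2 / sqrt (1 - m * (cos \<theta>)\<^sup>2) ^ 3))) / (2 * m))
     has_integral (ellC m - ellB m - 0) / (2 * m)) {0..pi/2}"
    using assms by (intro has_integral_divide has_integral_diff has_integral_ellB has_integral_ellC
      has_integral_total_derivative) auto
  moreover have "((cos \<theta>)\<^sup>2 / D - (sin \<theta>)\<^sup>2 / D - (((cos \<theta>)\<^sup>2 - (sin \<theta>)\<^sup>2) / D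
       - m * ((sin \<theta>)\<^sup>2 * (cos \<theta>)\<^sup>2 / D ^ 3))) / (2 * m) = (sin \<theta>)\<^sup>2 * (cos \<theta>)\<^sup>2 / (2 * D ^ 3)" for D \<theta>
    using assms by (simp add: diff_divide_distrib)
  ultimately show ?thesis by simp
qed

text \<open>With D the root, sin^2 / D plus the total derivative is (1 - m) cos^2 / D^3. Halving,
  dividing by 1 - m and subtracting the integrand of B' turns cos^2 into cos^4.\<close>

lemma has_integral_ellC_deriv:
  assumes "0 < m" "m < 1"
  shows "((\<lambda>\<theta>. (cos \<theta>)\<^sup>2 * (cos \<theta>)\<^sup>2 / (2 * sqrt (1 - m * (cos \<theta>)\<^sup>2) ^ 3))
    has_integral ellB m / (2 * (1 - m)) - (ellC m - ellB m) / (2 * m)) {0..pi/2}"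
proof -
  have "((\<lambda>\<theta>. ((sin \<theta>)\<^sup>2 / sqrt (1 - m * (cos \<theta>)\<^sup>2) +
     (((cos \<theta>)\<^sup>2 - (sin \<theta>)\<^sup>2) / sqrt (1 - m * (cos \<theta>)\<^sup>2)
       - m * ((sin \<theta>)\<^sup>2 * (cos \<theta>)\<^sup>2 / sqrt (1 - m * (cos \<theta>)\<^sup>2) ^ 3))) / (2 * (1 - m))
      - (sin \<theta>)\<^sup>2 * (cos \<theta>)\<^sup>2 / (2 * sqrt (1 - m * (cos \<theta>)\<^sup>2) ^ 3))
     has_integral (ellB m + 0) / (2 * (1 - m)) - (ellC m - ellB m) / (2 * m)) {0..pi/2}"
    using assms by (intro has_integral_divide has_integral_diff has_integral_add has_integral_ellB
      has_integral_total_derivative has_integral_ellB_deriv) auto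
  moreover have "((sin \<theta>)\<^sup>2 / sqrt (1 - m * (cos \<theta>)\<^sup>2) +
     (((cos \<theta>)\<^sup>2 - (sin \<theta>)\<^sup>2) / sqrt (1 - m * (cos \<theta>)\<^sup>2)
       - m * ((sin \<theta>)\<^sup>2 * (cos \<theta>)\<^sup>2 / sqrt (1 - m * (cos \<theta>)\<^sup>2) ^ 3))) / (2 * (1 - m))
      - (sin \<theta>)\<^sup>2 * (cos \<theta>)\<^sup>2 / (2 * sqrt (1 - m * (cos \<theta>)\<^sup>2) ^ 3)
     = (cos \<theta>)\<^sup>2 * (cos \<theta>)\<^sup>2 / (2 * sqrt (1 - m * (cos \<theta>)\<^sup>2) ^ 3)" for \<theta>
  proof -
    define D c where "D = sqrt (1 - m * (cos \<theta>)\<^sup>2)" and "c = (cos \<theta>)\<^sup>2"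
    have D: "0 < D" "D\<^sup>2 = 1 - m * c"
      unfolding D_def c_def using mult_cos_sq_less_1[of m \<theta>] assms by auto
    have D': "((1 - c) / D + ((c - (1 - c)) / D - m * ((1 - c) * c / D ^ 3))) = (c * D\<^sup>2 - m * (1 - c) * c) / D ^ 3"
      using D(1) by (simp add: field_simps power2_eq_square power3_eq_cube)
    also have "c * D\<^sup>2 - m * (1 - c) * c = (1 - m) * c"
      unfolding D(2) by (simp add: algebra_simps)
    finally have h: "((1 - c) / D + ((c - (1 - c)) / D - m * ((1 - c) * c / D ^ 3))) / (2 * (1 - m)) = c / (2 * D ^ 3)"
      using assms D(1) by (simp add: divide_simps)
    show ?thesis
      unfolding D_def[symmetric]
      unfolding sin_squared_eq c_def[symmetric] h
      by (simp add: diff_divide_distrib[symmetric] algebra_simps)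
  qed
  ultimately show ?thesis by simp
qed

text \<open>Differentiation under the integral sign; the general weight serves B and C at
  once.\<close>

lemma DERIV_integral_div_sqrt:
  assumes m: "0 < m" "m < 1" and "continuous_on {0..pi/2} w"
  shows "((\<lambda>m. integral {0..pi/2} (\<lambda>\<theta>. w \<theta> / sqrt (1 - m * (cos \<theta>)\<^sup>2))) has_real_derivative
    integral {0..pi/2} (\<lambda>\<theta>. w \<theta> * (cos \<theta>)\<^sup>2 / (2 * sqrt (1 - m * (cos \<theta>)\<^sup>2) ^ 3))) (at m)"
proof -
  have pos: "0 < 1 - x * (cos t)\<^sup>2" if "x \<in> {0<..<1}" for x t :: real
    using that mult_cos_sq_less_1[of x t] by auto
  then have nz: "sqrt (1 - x * (cos t)\<^sup>2) \<noteq> 0" if "x \<in> {0<..<1}" for x t :: real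
    using that by (metis less_irrefl real_sqrt_gt_zero)
  have "((\<lambda>m. integral (cbox 0 (pi/2)) (\<lambda>\<theta>. w \<theta> / sqrt (1 - m * (cos \<theta>)\<^sup>2))) has_real_derivative
    integral (cbox 0 (pi/2)) (\<lambda>\<theta>. w \<theta> * (cos \<theta>)\<^sup>2 / (2 * sqrt (1 - m * (cos \<theta>)\<^sup>2) ^ 3))) (at m within {0<..<1})"
  proof (rule leibniz_rule_field_derivative)
    fix x t :: real assume x: "x \<in> {0<..<1}"
    define D where "D = sqrt (1 - x * (cos t)\<^sup>2)"
    have D: "0 < D" "D * D = 1 - x * (cos t)\<^sup>2" unfolding D_def using pos[OF x, of t] by auto
    have "((\<lambda>x. sqrt (1 - x * (cos t)\<^sup>2)) has_real_derivative - ((cos t)\<^sup>2 / (2 * D))) (at x)"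
      using pos[OF x, of t] by (auto intro!: derivative_eq_intros simp: D_def field_simps)
    then have "((\<lambda>x. w t / sqrt (1 - x * (cos t)\<^sup>2)) has_real_derivative
      (0 * D - w t * - ((cos t)\<^sup>2 / (2 * D))) / (D * D)) (at x)"
      using D(1) unfolding D_def by (intro DERIV_divide DERIV_const) auto
    also have "(0 * D - w t * - ((cos t)\<^sup>2 / (2 * D))) / (D * D) = w t * (cos t)\<^sup>2 / (2 * D ^ 3)"
      using D(1) by (simp add: field_simps power3_eq_cube)
    finally show "((\<lambda>x. w t / sqrt (1 - x * (cos t)\<^sup>2)) has_real_derivative
        w t * (cos t)\<^sup>2 / (2 * sqrt (1 - x * (cos t)\<^sup>2) ^ 3)) (at x within {0<..<1})"
      unfolding D_def by (rule has_field_derivative_at_within)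
  next
    fix x :: real assume x: "x \<in> {0<..<1}"
    have "continuous_on {0..pi/2} (\<lambda>t. sqrt (1 - x * (cos t)\<^sup>2))" by (intro continuous_intros)
    then have "continuous_on {0..pi/2} (\<lambda>t. w t / sqrt (1 - x * (cos t)\<^sup>2))"
      by (rule continuous_on_divide[OF assms(3)]) (intro ballI nz[OF x])
    then show "(\<lambda>t. w t / sqrt (1 - x * (cos t)\<^sup>2)) integrable_on cbox 0 (pi/2)"
      by (intro integrable_continuous) (simp only: cbox_interval)
  next
    let ?S = "{0<..<1::real} \<times> cbox 0 (pi/2)"
    have c1: "continuous_on ?S (\<lambda>x. w (snd x))"
      by (intro continuous_on_compose2[OF assms(3) continuous_on_snd[OF continuous_on_id]]) auto
    have c2: "continuous_on ?S (\<lambda>x. (cos (snd x))\<^sup>2)"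
      and c3: "continuous_on ?S (\<lambda>x. 2 * sqrt (1 - fst x * (cos (snd x))\<^sup>2) ^ 3)"
      by (intro continuous_intros)+
    have nz': "2 * sqrt (1 - fst x * (cos (snd x))\<^sup>2) ^ 3 \<noteq> 0" if "x \<in> ?S" for x
    proof -
      have "fst x \<in> {0<..<1}" using that by auto
      from nz[OF this, of "snd x"] show ?thesis by simp
    qed
    show "continuous_on ?S (\<lambda>(x, t). w t * (cos t)\<^sup>2 / (2 * sqrt (1 - x * (cos t)\<^sup>2) ^ 3))"
      unfolding split_beta
      by (rule continuous_on_divide[OF continuous_on_mult[OF c1 c2] c3]) (intro ballI nz')
  qed (use m in auto)
  then show ?thesis
    using m by (simp add: at_within_open[of m "{0<..<1}"])
qed

text \<open>By \<open>ellT_eq\<close>, T - 2 B = (1 - m) (C - B), so this equals (T - 2 B) / (2 m (1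
  - m)).\<close>

lemma ellB_deriv:
  assumes "0 < m" "m < 1"
  shows "(ellB has_real_derivative (ellC m - ellB m) / (2 * m)) (at m)"
proof -
  have "continuous_on {0..pi/2} (\<lambda>\<theta>::real. (sin \<theta>)\<^sup>2)" by (intro continuous_intros)
  from DERIV_integral_div_sqrt[OF assms this] show ?thesis
    unfolding ellB_def[abs_def, symmetric] integral_unique[OF has_integral_ellB_deriv[OF assms]] .
qed

lemma ellC_deriv:
  assumes "0 < m" "m < 1"
  shows "(ellC has_real_derivative ellB m / (2 * (1 - m)) - (ellC m - ellB m) / (2 * m)) (at m)"
proof -
  have "continuous_on {0..pi/2} (\<lambda>\<theta>::real. (cos \<theta>)\<^sup>2)" by (intro continuous_intros)
  from DERIV_integral_div_sqrt[OF assms this] show ?thesis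
    unfolding ellC_def[abs_def, symmetric] integral_unique[OF has_integral_ellC_deriv[OF assms]] .
qed

lemma ellT_deriv:
  assumes "0 < m" "m < 1"
  shows "(ellT has_real_derivative ellB m / 2) (at m)"
proof -
  define x y where "x = (ellC m - ellB m) / (2 * m)" and "y = ellB m / (2 * (1 - m))"
  have dB: "(ellB has_real_derivative x) (at m)" and dC: "(ellC has_real_derivative y - x) (at m)"
    unfolding x_def y_def by (rule ellB_deriv[OF assms], rule ellC_deriv[OF assms])
  have "((\<lambda>m. (1 + m) * ellB m + (1 - m) * ellC m) has_real_derivative
      ellB m + (1 + m) * x + ((1 - m) * (y - x) - ellC m)) (at m)"
    by (auto intro!: derivative_eq_intros dB dC simp: algebra_simps)
  also have "ellB m + (1 + m) * x + ((1 - m) * (y - x) - ellC m) = ellB m - ellC m + 2 * m * x + (1 - m) * y"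
    by (simp add: algebra_simps)
  also have "\<dots> = ellB m / 2"
    using assms by (simp add: x_def y_def divide_simps)
  finally have "((\<lambda>m. (1 + m) * ellB m + (1 - m) * ellC m) has_real_derivative ellB m / 2) (at m)" .
  moreover have "\<forall>\<^sub>F x in nhds m. (1 + x) * ellB x + (1 - x) * ellC x = ellT x"
    using eventually_nhds_in_open[of "{0<..<1}" m] assms by (auto elim!: eventually_mono simp: ellT_eq)
  ultimately show ?thesis by (subst DERIV_cong_ev[OF refl _ refl, symmetric])
qed

text \<open>The integrand of B' is nonnegative, hence so is the numerator C - B of its closed
  form.\<close>

lemma ellB_le_ellC:
  assumes "0 \<le> m" "m < 1"
  shows "ellB m \<le> ellC m"
proof (cases "m = 0")
  case False
  have "0 \<le> (ellC m - ellB m) / (2 * m)"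
    by (rule has_integral_nonneg[OF has_integral_ellB_deriv])
      (use assms False in \<open>auto intro!: divide_nonneg_nonneg zero_le_power simp: mult_cos_sq_le_1\<close>)
  then show ?thesis using assms False by (simp add: zero_le_divide_iff)
qed (simp add: ellB_0 ellC_0)

text \<open>The line passes through T(1) = 2 with slope B(1) / 2 = 1/2; T' = B / 2 <= 1/2 keeps T
  above it.\<close>

lemma ellT_ge_linear:
  assumes "0 \<le> m" "m \<le> 1"
  shows "(3 + m) / 2 \<le> ellT m"
proof -
  have "(3 + m) / 2 - ellT m \<le> (3 + 1) / 2 - ellT 1"
  proof (rule DERIV_nonneg_imp_increasing_open[where f = "\<lambda>x. (3 + x) / 2 - ellT x"])
    fix x assume x: "m < x" "x < 1"
    show "\<exists>y. ((\<lambda>x. (3 + x) / 2 - ellT x) has_real_derivative y) (at x) \<and> 0 \<le> y"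
      using x assms ellB_le_1[of x]
      by (intro exI[of _ "1/2 - ellB x / 2"]) (auto intro!: derivative_eq_intros ellT_deriv)
  qed (use assms in \<open>auto intro!: continuous_intros continuous_on_subset[OF continuous_on_ellT]\<close>)
  then show ?thesis by (simp add: ellT_1)
qed

text \<open>The bound for B / 2 integrated from T(0) = pi / 2, hence exact at m = 0.\<close>

lemma ellT_ge_cubic:
  assumes "0 \<le> m" "m \<le> 1"
  shows "pi / 2 * (1 + m / 4 + m\<^sup>2 / 64 + m ^ 3 / 256) \<le> ellT m"
proof -
  let ?f = "\<lambda>x. ellT x - pi / 2 * (1 + x / 4 + x\<^sup>2 / 64 + x ^ 3 / 256)"
  have "?f 0 \<le> ?f m"
  proof (rule DERIV_nonneg_imp_increasing_open[where f = ?f])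
    fix x assume x: "0 < x" "x < m"
    show "\<exists>y. (?f has_real_derivative y) (at x) \<and> 0 \<le> y"
      using x assms ellB_ge_poly[of x]
      by (intro exI[of _ "ellB x / 2 - pi / 2 * (1 / 4 + x / 32 + 3 * x\<^sup>2 / 256)"])
        (auto intro!: derivative_eq_intros ellT_deriv simp: field_simps)
  qed (use assms in \<open>auto intro!: continuous_intros continuous_on_subset[OF continuous_on_ellT]\<close>)
  then show ?thesis by (simp add: ellT_0)
qed

lemma ellT_mono:
  assumes "0 \<le> m" "m \<le> n" "n \<le> 1"
  shows "ellT m \<le> ellT n"
proof (rule DERIV_nonneg_imp_increasing_open[OF assms(2)])
  fix x assume x: "m < x" "x < n"
  show "\<exists>y. (ellT has_real_derivative y) (at x) \<and> 0 \<le> y"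
    using x assms ellB_pos[of x] by (intro exI[of _ "ellB x / 2"]) (auto intro!: ellT_deriv)
qed (use assms in \<open>auto intro!: continuous_intros continuous_on_subset[OF continuous_on_ellT]\<close>)

lemma ellT_le_2: "0 \<le> m \<Longrightarrow> m \<le> 1 \<Longrightarrow> ellT m \<le> 2"
  using ellT_mono[of m 1] ellT_1 by simp

section \<open>Comparison of the elliptic integrals\<close>

text \<open>At a negative minimum left of b the derivative would force a smaller value further
  right. The sign condition is restricted to f < 0, the form in which a linear differential equation
  supplies it.\<close>

lemma nonneg_if_decreasing_where_negative:
  fixes f :: "real \<Rightarrow> real"
  assumes "a \<le> b" "continuous_on {a..b} f" "0 \<le> f b"
    and deriv: "\<And>x. a \<le> x \<Longrightarrow> x < b \<Longrightarrow> f x < 0 \<Longrightarrow> \<exists>d<0. (f has_real_derivative d) (at x)"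
  shows "0 \<le> f a"
proof -
  obtain x where x: "x \<in> {a..b}" "\<And>y. y \<in> {a..b} \<Longrightarrow> f x \<le> f y"
    using continuous_attains_inf[of "{a..b}" f] assms by auto
  have "0 \<le> f x"
  proof (rule ccontr)
    assume neg: "\<not> 0 \<le> f x"
    then have "x \<noteq> b" using assms(3) by auto
    with x have "a \<le> x" "x < b" by auto
    then obtain d where "d < 0" "(f has_real_derivative d) (at x)" using deriv[of x] neg by auto
    then obtain h0 where h0: "0 < h0" "\<And>h. 0 < h \<Longrightarrow> h < h0 \<Longrightarrow> f (x + h) < f x"
      using DERIV_neg_dec_right[of f d x] by auto
    define h where "h = min (h0 / 2) (b - x)"
    have "0 < h" "h < h0" "x + h \<in> {a..b}" using h0(1) \<open>x < b\<close> x(1) by (auto simp: h_def)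
    then show False using h0(2) x(2)[of "x + h"] by force
  qed
  then show ?thesis using x(2)[of a] assms(1) by auto
qed

text \<open>Solving \<open>ellT_eq\<close> for C avoids another argument about parameter
  integrals.\<close>

lemma continuous_on_ellC: "continuous_on {0..<1} ellC"
proof -
  have "continuous_on {0..<1} (\<lambda>m. (ellT m - (1 + m) * ellB m) / (1 - m))"
    by (intro continuous_on_divide continuous_on_diff continuous_on_mult continuous_on_add
        continuous_on_const continuous_on_id continuous_on_subset[OF continuous_on_ellT]
        continuous_on_subset[OF continuous_on_ellB]) auto
  then show ?thesis
    by (rule continuous_on_eq) (auto simp: ellT_eq)
qed

text \<open>Along \<open>m = 1 - e\<^sup>4\<close> the difference \<open>w = ellB - e ellC\<close> satisfies a linear equation which
  gives \<open>w' < 0\<close> wherever \<open>w < 0\<close>; since \<open>w\<close> vanishes at \<open>e = 1\<close>, it cannot be negative.\<close>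

lemma mult_ellC_le_ellB:
  assumes "0 < e" "e \<le> 1"
  shows "e * ellC (1 - e ^ 4) \<le> ellB (1 - e ^ 4)"
proof -
  have in01: "1 - x ^ 4 \<in> {0..<1}" if "e \<le> x" "x \<le> 1" for x
    using that assms power_le_one[of x 4] by auto
  have "0 \<le> ellB (1 - e ^ 4) - e * ellC (1 - e ^ 4)"
  proof (rule nonneg_if_decreasing_where_negative[of e 1 "\<lambda>x. ellB (1 - x ^ 4) - x * ellC (1 - x ^ 4)"])
    have 1: "continuous_on {e..1} (\<lambda>x. ellB (1 - x ^ 4))"
      by (rule continuous_on_compose2[OF continuous_on_ellB]) (use in01 in \<open>force intro!: continuous_intros\<close>)+
    have 2: "continuous_on {e..1} (\<lambda>x. ellC (1 - x ^ 4))"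
      by (rule continuous_on_compose2[OF continuous_on_ellC]) (use in01 in \<open>force intro!: continuous_intros\<close>)+
    show "continuous_on {e..1} (\<lambda>x. ellB (1 - x ^ 4) - x * ellC (1 - x ^ 4))"
      by (intro continuous_on_diff continuous_on_mult continuous_on_id 1 2)
  next
    fix x assume x: "e \<le> x" "x < 1" and neg: "ellB (1 - x ^ 4) - x * ellC (1 - x ^ 4) < 0"
    define m where "m = 1 - x ^ 4"
    have "x ^ 4 < 1" using x assms power_strict_mono[of x 1 4] by auto
    then have m: "0 < m" "m < 1" using x assms by (auto simp: m_def)
    define B where "B = ellB m"
    define C where "C = ellC m"
    define r where "r = (C - B) / (2 * m)"
    have g: "((\<lambda>x. 1 - x ^ 4) has_real_derivative - 4 * x ^ 3) (at x)"
      by (auto intro!: derivative_eq_intros)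
    have dB: "((\<lambda>x. ellB (1 - x ^ 4)) has_real_derivative r * (- 4 * x ^ 3)) (at x)"
      using DERIV_chain2[OF ellB_deriv[OF m, unfolded m_def] g] by (simp add: r_def B_def C_def m_def)
    have dC: "((\<lambda>x. ellC (1 - x ^ 4)) has_real_derivative (B / (2 * (1 - m)) - r) * (- 4 * x ^ 3)) (at x)"
      using DERIV_chain2[OF ellC_deriv[OF m, unfolded m_def] g] by (simp add: r_def B_def C_def m_def)
    define d where "d = r * (- 4 * x ^ 3) - (1 * C + (B / (2 * (1 - m)) - r) * (- 4 * x ^ 3) * x)"
    have "((\<lambda>x. ellB (1 - x ^ 4) - x * ellC (1 - x ^ 4)) has_real_derivative d) (at x)"
      unfolding d_def C_def m_def by (intro DERIV_diff DERIV_mult DERIV_ident dB dC[unfolded m_def])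
    moreover have "d < 0"
    proof -
      have x4: "1 - m = x ^ 4" by (simp add: m_def)
      define w where "w = B - x * C"
      have w: "w < 0" using neg by (simp add: w_def B_def C_def m_def)
      have "d = - 4 * x ^ 3 * (1 + x) * r - C + 2 * B"
        using x assms unfolding d_def x4 by (simp add: field_simps eval_nat_numeral)
      \<comment> \<open>Eliminating B through w leaves a linear equation for w: the coefficient of C
        is minus a square over a positive number, that of w is positive.\<close>
      also have "\<dots> = - ((1 - x)\<^sup>2 / (1 + x\<^sup>2)) * C + (2 * x ^ 3 * (1 + x) / m + 2) * w"
      proof -
        have mf: "m = (1 - x) * (1 + x) * (1 + x\<^sup>2)" by (simp add: m_def field_simps eval_nat_numeral)
        have nz: "1 - x \<noteq> 0" "1 + x \<noteq> 0" "1 + x\<^sup>2 \<noteq> 0" using x assms by (auto simp: add_nonneg_eq_0_iff)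
        have r: "(1 + x) * r = C / (2 * (1 + x\<^sup>2)) - (1 + x) * w / (2 * m)"
          unfolding r_def w_def mf using nz by (simp add: divide_simps) (simp add: algebra_simps)
        have B: "B = w + x * C" by (simp add: w_def)
        have "- 4 * x ^ 3 * (1 + x) * r - C + 2 * B = - 4 * x ^ 3 * (C / (2 * (1 + x\<^sup>2)) - (1 + x) * w / (2 * m)) - C + 2 * (w + x * C)"
          by (subst r[symmetric], subst B) (simp add: algebra_simps)
        also have "\<dots> = (2 * x - 1 - 2 * x ^ 3 / (1 + x\<^sup>2)) * C + (2 * x ^ 3 * (1 + x) / m + 2) * w"
        proof -
          have "C / (2 * (1 + x\<^sup>2)) = (1 / (1 + x\<^sup>2)) * C / 2" "(1 + x) * w / (2 * m) = (1 / m) * ((1 + x) * w / 2)"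
            "2 * x ^ 3 / (1 + x\<^sup>2) = (1 / (1 + x\<^sup>2)) * (2 * x ^ 3)"
            "2 * x ^ 3 * (1 + x) / m = (1 / m) * (2 * x ^ 3 * (1 + x))"
            by (simp_all add: field_simps)
          \<comment> \<open>Here a and b stand for 1 / (1 + x^2) and 1 / m, so that the identity is
            polynomial.\<close>
          moreover have "- 4 * x ^ 3 * (a * C / 2 - b * ((1 + x) * w / 2)) - C + 2 * (w + x * C)
            = (2 * x - 1 - a * (2 * x ^ 3)) * C + (b * (2 * x ^ 3 * (1 + x)) + 2) * w" for a b
            by algebra
          ultimately show ?thesis by (simp only:)
        qed
        also have "2 * x - 1 - 2 * x ^ 3 / (1 + x\<^sup>2) = - ((1 - x)\<^sup>2 / (1 + x\<^sup>2))"
          using nz by (simp add: divide_simps) (simp add: algebra_simps power2_eq_square power3_eq_cube)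
        finally show ?thesis .
      qed
      also have "\<dots> < 0"
      proof -
        have "0 \<le> C" using ellB_le_ellC[of m] ellB_pos[of m] m by (simp add: C_def)
        then have "0 \<le> ((1 - x)\<^sup>2 / (1 + x\<^sup>2)) * C" by simp
        moreover have "(2 * x ^ 3 * (1 + x) / m + 2) * w < 0"
          using w x assms m by (intro mult_pos_neg add_nonneg_pos) auto
        ultimately show ?thesis by simp
      qed
      finally show ?thesis .
    qed
    ultimately show "\<exists>d<0. ((\<lambda>x. ellB (1 - x ^ 4) - x * ellC (1 - x ^ 4)) has_real_derivative d) (at x)"
      by blast
  qed (use assms ellB_0 ellC_0 in auto)
  then show ?thesis by simp
qed

text \<open>Weakening by e^4 <= e, where e^4 = 1 - m; it fixes the sign in
  \<open>one_minus_ellB_sq_antimono\<close>.\<close>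

lemma mult_one_minus_ellC_le_ellB:
  assumes "0 \<le> m" "m < 1"
  shows "(1 - m) * ellC m \<le> ellB m"
proof -
  define e where "e = root 4 (1 - m)"
  have e: "0 < e" "e \<le> 1" "1 - e ^ 4 = m" using assms by (auto simp: e_def)
  have C: "0 \<le> ellC m" using ellB_le_ellC[OF assms] ellB_pos[of m] assms by simp
  have "1 - m \<le> e" using e power_decreasing[of 1 4 e] by auto
  then have "(1 - m) * ellC m \<le> e * ellC m" using C by (rule mult_right_mono)
  also have "\<dots> \<le> ellB m" using mult_ellC_le_ellB[OF e(1,2)] e(3) by simp
  finally show ?thesis .
qed

lemma ellT_ge_2_ellB:
  assumes "0 \<le> m" "m \<le> 1"
  shows "2 * ellB m \<le> ellT m"
proof (cases "m = 1")
  case False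
  then have "(1 - m) * ellB m \<le> (1 - m) * ellC m"
    using assms ellB_le_ellC[of m] by (intro mult_left_mono) auto
  then show ?thesis using False assms by (simp add: ellT_eq algebra_simps)
qed (simp add: ellB_1 ellT_1)

section \<open>Rational bounds for pi^2 and polynomial certificates\<close>

lemma pi_sq_bounds: "9.8696 \<le> pi\<^sup>2" "pi\<^sup>2 \<le> 9.8697"
proof -
  have "3.14159265\<^sup>2 \<le> pi\<^sup>2" "pi\<^sup>2 \<le> 3.14159266\<^sup>2"
    using pi_approx by (intro power_mono; simp)+
  then show "9.8696 \<le> pi\<^sup>2" "pi\<^sup>2 \<le> 9.8697" by (auto simp: power2_eq_square)
qed

text \<open>The maximum is attained at e = 3/4, hence the double root.\<close>

lemma cube_mult_one_minus_le: "e ^ 3 * (1 - e) \<le> 27/256" for e :: real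
proof -
  have "27/256 - e ^ 3 * (1 - e) = (e - 3/4)\<^sup>2 * ((e + 1/4)\<^sup>2 + 1/8)" by algebra
  also have "\<dots> \<ge> 0" by (intro mult_nonneg_nonneg add_nonneg_nonneg) auto
  finally show ?thesis by simp
qed

text \<open>The univariate polynomial inequalities below are certified by nonnegative coefficients in the
  Bernstein basis of the relevant interval.\<close>

lemma poly_ineq_left:
  fixes e :: real
  assumes "0 \<le> e" "e \<le> 16/25"
  shows "0 \<le> 48/100 - 225/100 * e\<^sup>2 + 25/10 * e ^ 3 - 124/100 * e ^ 4"
proof -
  define u where "u = 25/16 * e"
  have u: "0 \<le> u" "0 \<le> 1 - u" and e: "e = 16/25 * u" using assms by (auto simp: u_def)
  have "48/100 - 225/100 * e\<^sup>2 + 25/10 * e ^ 3 - 124/100 * e ^ 4 =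
    12/25 * (1 - u) ^ 4 + 48/25 * u * (1 - u) ^ 3 + 1224/625 * u ^ 2 * (1 - u) ^ 2 +
      2288/3125 * u ^ 3 * (1 - u) + 55884/9765625 * u ^ 4"
    unfolding e by algebra
  also have "\<dots> \<ge> 0" using u by (intro add_nonneg_nonneg mult_nonneg_nonneg zero_le_power) auto
  finally show ?thesis .
qed

text \<open>In h the right side has degree 12 and starts with 1 + h - 5/4 h^2 + 1/2 h^3. Lowering
  1/2 to 19/40 leaves a cubic that is cheap to square and a remainder that is still positive after
  division by h^3.\<close>

lemma poly_ineq_right_aux:
  fixes h :: real
  assumes "0 \<le> h" "h \<le> 9/25"
  defines "m \<equiv> 1 - (1 - h) ^ 4"
  shows "1 + h - 5/4 * h\<^sup>2 + 19/40 * h ^ 3 \<le> 1 + m / 4 + m\<^sup>2 / 64 + m ^ 3 / 256"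
proof -
  define u where "u = 25/9 * h"
  have u: "0 \<le> u" "0 \<le> 1 - u" and h: "h = 9/25 * u" using assms by (auto simp: u_def)
  have "1 + m / 4 + m\<^sup>2 / 64 + m ^ 3 / 256 - (1 + h - 5/4 * h\<^sup>2 + 19/40 * h ^ 3) = h ^ 3 * (
    1/40 * (1 - u) ^ 9 + 9/80 * u * (1 - u) ^ 8 + 81/400 * u ^ 2 * (1 - u) ^ 7 +
      117411/500000 * u ^ 3 * (1 - u) ^ 6 + 1108503/3125000 * u ^ 4 * (1 - u) ^ 5 +
      47050659/78125000 * u ^ 5 * (1 - u) ^ 4 + 2101858791/3125000000 * u ^ 6 * (1 - u) ^ 3 +
      337087027773/781250000000 * u ^ 7 * (1 - u) ^ 2 +
      1435473793863/9765625000000 * u ^ 8 * (1 - u) + 20279357562061/976562500000000 * u ^ 9)"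
    unfolding m_def h by algebra
  also have "\<dots> \<ge> 0"
    using u assms(1) by (intro add_nonneg_nonneg mult_nonneg_nonneg zero_le_power) auto
  finally show ?thesis by simp
qed

text \<open>61685/100000 rounds pi^2 / 16 down; 1027/1000 and 967/1000 linearise x + x^2 / 4 and x -
  5/16 x^2 by means of x <= 27/256. Both sides are 1 at h = 0, hence the factor h in the
  certificate.\<close>

lemma poly_ineq_right:
  fixes h :: real
  assumes "0 \<le> h" "h \<le> 9/25"
  defines "y \<equiv> (1 - h) ^ 4" and "x \<equiv> (1 - h) ^ 3 * h"
  shows "1 + 1027/1000 * x \<le>
    (1 + h - 5/4 * h\<^sup>2 + 19/40 * h ^ 3)\<^sup>2 * (y + 61685/100000 * (1 - y + 967/1000 * x))"
proof -
  define u where "u = 25/9 * h"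
  have u: "0 \<le> u" "0 \<le> 1 - u" and h: "h = 9/25 * u" using assms by (auto simp: u_def)
  have "(1 + h - 5/4 * h\<^sup>2 + 19/40 * h ^ 3)\<^sup>2 * (y + 61685/100000 * (1 - y + 967/1000 * x))
      - (1 + 1027/1000 * x) = h * (
    737879/20000000 * (1 - u) ^ 9 + 25662483/62500000 * u * (1 - u) ^ 8 +
      42593752809/25000000000 * u ^ 2 * (1 - u) ^ 7 +
      23373441078519/6250000000000 * u ^ 3 * (1 - u) ^ 6 +
      3073967388256707/625000000000000 * u ^ 4 * (1 - u) ^ 5 +
      2530464769667097/625000000000000 * u ^ 5 * (1 - u) ^ 4 +
      16172617104383232039/7812500000000000000 * u ^ 6 * (1 - u) ^ 3 +
      3751318040648065371/6103515625000000000 * u ^ 7 * (1 - u) ^ 2 +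
      3329280574280945649/38146972656250000000 * u ^ 8 * (1 - u) +
      40393022850314534773/15258789062500000000000 * u ^ 9)"
    unfolding x_def y_def h by algebra
  also have "\<dots> \<ge> 0"
    using u assms(1) by (intro add_nonneg_nonneg mult_nonneg_nonneg zero_le_power) auto
  finally show ?thesis by simp
qed

section \<open>The threshold inequality\<close>

text \<open>With y = 1 - m, the factor 2 - y / 2 is the bound (3 + m) / 2 for T, and 62/100 is a
  lower bound for the threshold. Since x^2 is a multiple of y, the leading terms are y times the
  quartic of \<open>poly_ineq_left\<close>.\<close>

lemma poly_ineq_near_1:
  fixes e :: real
  assumes "0 \<le> e" "e \<le> 16/25"
  defines "y \<equiv> e ^ 4" and "x \<equiv> e ^ 3 * (1 - e)"
  shows "(2 + x)\<^sup>2 \<le> (2 - y / 2)\<^sup>2 * ((2 + x)\<^sup>2 / 4 + (62/100 * y - 9/16 * x\<^sup>2))"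
proof -
  have x: "0 \<le> x" "x \<le> 1" and y: "0 \<le> y"
    using assms cube_mult_one_minus_le[of e] by (auto simp: x_def y_def)
  have "(2 - y / 2)\<^sup>2 * ((2 + x)\<^sup>2 / 4 + (62/100 * y - 9/16 * x\<^sup>2)) - (2 + x)\<^sup>2
    = (48/100 * y - 225/100 * x\<^sup>2 - 2 * x * y - 99/100 * y\<^sup>2)
      + (5/8 * (x\<^sup>2 * y) + y\<^sup>2 / 4 * (x * (1 - 5/16 * x) + 62/100 * y))"
    by (simp add: power2_eq_square field_simps)
  also have "48/100 * y - 225/100 * x\<^sup>2 - 2 * x * y - 99/100 * y\<^sup>2
    = y * (48/100 - 225/100 * e\<^sup>2 + 25/10 * e ^ 3 - 124/100 * e ^ 4)"
    unfolding x_def y_def by algebra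
  also have "0 \<le> y * (48/100 - 225/100 * e\<^sup>2 + 25/10 * e ^ 3 - 124/100 * e ^ 4)
      + (5/8 * (x\<^sup>2 * y) + y\<^sup>2 / 4 * (x * (1 - 5/16 * x) + 62/100 * y))"
    using poly_ineq_left[OF assms(1,2)] x y
    by (intro add_nonneg_nonneg mult_nonneg_nonneg) auto
  finally show ?thesis by simp
qed

text \<open>Here p stands for pi^2 / 16. Its coefficient is nonnegative, so a rational lower bound
  may replace it; at e = 1 both sides equal 4 for every p, so the rounding costs nothing at the
  tight end.\<close>

lemma poly_ineq_near_0:
  fixes e p :: real
  assumes "16/25 \<le> e" "e \<le> 1" and p: "61685/100000 \<le> p"
  defines "m \<equiv> 1 - e ^ 4" and "x \<equiv> e ^ 3 * (1 - e)"
  shows "(2 + x)\<^sup>2 \<le> (1 + m / 4 + m\<^sup>2 / 64 + m ^ 3 / 256)\<^sup>2 *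
    (4 * (p * ((2 + x)\<^sup>2 / 4 - 9/16 * x\<^sup>2 - e ^ 4) + e ^ 4))"
proof -
  define h where "h = 1 - e"
  have h: "0 \<le> h" "h \<le> 9/25" "1 - h = e" using assms by (auto simp: h_def)
  have x: "0 \<le> x" "x \<le> 27/256" using assms cube_mult_one_minus_le[of e] by (auto simp: x_def)
  have m: "0 \<le> m" using assms power_le_one[of e 4] by (simp add: m_def)
  have x2: "x\<^sup>2 \<le> 27/256 * x" using mult_right_mono[OF x(2,1)] by (simp add: power2_eq_square)
  define s where "s = 1 + h - 5/4 * h\<^sup>2 + 19/40 * h ^ 3"
  have "h\<^sup>2 \<le> (9/25)\<^sup>2" using h by (intro power_mono) auto
  then have s0: "0 \<le> s" using h zero_le_power[OF h(1), of 3] by (simp add: s_def power2_eq_square)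
  have s: "s \<le> 1 + m / 4 + m\<^sup>2 / 64 + m ^ 3 / 256"
    using poly_ineq_right_aux[OF h(1,2)] by (simp add: s_def m_def h(3))
  have "(2 + x)\<^sup>2 \<le> 4 * (1 + 1027/1000 * x)" using x2 x by (simp add: power2_eq_square algebra_simps)
  also have "\<dots> \<le> 4 * (s\<^sup>2 * (e ^ 4 + 61685/100000 * (1 - e ^ 4 + 967/1000 * x)))"
  proof (rule mult_left_mono)
    have "(1 - h) ^ 3 * h = x" by (simp add: x_def h_def)
    then show "1 + 1027/1000 * x \<le> s\<^sup>2 * (e ^ 4 + 61685/100000 * (1 - e ^ 4 + 967/1000 * x))"
      using poly_ineq_right[OF h(1,2)] by (simp only: s_def[symmetric] h(3))
  qed simp
  also have "\<dots> \<le> 4 * (s\<^sup>2 * (e ^ 4 + p * ((2 + x)\<^sup>2 / 4 - 9/16 * x\<^sup>2 - e ^ 4)))"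
  proof -
    have "967/1000 * x \<le> (2 + x)\<^sup>2 / 4 - 9/16 * x\<^sup>2 - 1"
      using x2 x by (simp add: power2_eq_square algebra_simps)
    then have "61685/100000 * (1 - e ^ 4 + 967/1000 * x) \<le> p * ((2 + x)\<^sup>2 / 4 - 9/16 * x\<^sup>2 - e ^ 4)"
      using m x p by (intro mult_mono) (auto simp: m_def)
    then show ?thesis by (intro mult_left_mono) auto
  qed
  also have "\<dots> = s\<^sup>2 * (4 * (p * ((2 + x)\<^sup>2 / 4 - 9/16 * x\<^sup>2 - e ^ 4) + e ^ 4))" by simp
  also have "\<dots> \<le> (1 + m / 4 + m\<^sup>2 / 64 + m ^ 3 / 256)\<^sup>2 * (4 * (p * ((2 + x)\<^sup>2 / 4 - 9/16 * x\<^sup>2 - e ^ 4) + e ^ 4))"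
  proof (rule mult_right_mono)
    show "s\<^sup>2 \<le> (1 + m / 4 + m\<^sup>2 / 64 + m ^ 3 / 256)\<^sup>2" using s s0 by (rule power_mono)
    have "0 \<le> (2 + x)\<^sup>2 / 4 - 9/16 * x\<^sup>2 - e ^ 4"
      using m x x2 by (simp add: m_def power2_eq_square algebra_simps)
    then show "0 \<le> 4 * (p * ((2 + x)\<^sup>2 / 4 - 9/16 * x\<^sup>2 - e ^ 4) + e ^ 4)" using p by simp
  qed
  finally show ?thesis .
qed

lemma threshold_bounds: "62/100 \<le> 16 / pi\<^sup>2 - 1" "16 / pi\<^sup>2 - 1 \<le> 625/1000"
  using pi_sq_bounds by (auto simp: field_simps)

text \<open>Since \<open>T \<le> (2 + x) B\<close>, where \<open>x = e\<^sup>3 (1 - e)\<close> and \<open>e\<^sup>4 = 1 - m\<close>, the claim reduces to a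
  polynomial lower bound for \<open>T\<close>. Both sides agree at \<open>m = 0\<close> and at \<open>m = 1\<close>.\<close>

lemma threshold_inequality:
  assumes "0 \<le> m" "m < 1"
  shows "1 - (ellT m)\<^sup>2 / 4 + 9/4 * (ellT m / 2 - ellB m)\<^sup>2 \<le> (16 / pi\<^sup>2 - 1) * ((1 - m) * (ellB m)\<^sup>2)"
proof -
  define e where "e = root 4 (1 - m)"
  have e: "0 < e" "e \<le> 1" "m = 1 - e ^ 4" using assms by (auto simp: e_def)
  define x where "x = e ^ 3 * (1 - e)"
  define B T \<gamma> where "B = ellB m" and "T = ellT m" and "\<gamma> = 16 / pi\<^sup>2 - 1"
  have x: "0 \<le> x" using e by (simp add: x_def)
  have B: "0 < B" using ellB_pos assms by (simp add: B_def)
  have T: "2 * B \<le> T" using ellT_ge_2_ellB assms by (simp add: B_def T_def)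
  have \<gamma>: "62/100 \<le> \<gamma>" using threshold_bounds by (simp add: \<gamma>_def)
  have "e ^ 3 * (e * ellC m) \<le> e ^ 3 * B"
    using mult_ellC_le_ellB[OF e(1,2)] e by (intro mult_left_mono) (auto simp: B_def)
  moreover have "T = (2 - e ^ 4) * B + e ^ 3 * (e * ellC m)"
  proof -
    have "1 + m = 2 - e ^ 4" "1 - m = e ^ 4" using e(3) by auto
    then have "T = (2 - e ^ 4) * B + e ^ 4 * ellC m" using ellT_eq[OF assms] by (simp add: T_def B_def)
    then show ?thesis by (simp add: eval_nat_numeral)
  qed
  ultimately have TB: "T \<le> (2 + x) * B" by (simp add: x_def algebra_simps eval_nat_numeral)
  \<comment> \<open>From T <= (2 + x) B, the term 9/4 (T / 2 - B)^2 is at most 9/16 x^2 B^2. K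
    absorbs it, and the claim becomes 1 <= T^2 / 4 + B^2 K.\<close>
  define K where "K = \<gamma> * e ^ 4 - 9/16 * x\<^sup>2"
  have x2: "x\<^sup>2 \<le> e ^ 4 / 16"
  proof -
    have "e * (1 - e) = 1/4 - (e - 1/2)\<^sup>2" by (simp add: power2_eq_square algebra_simps)
    then have "e * (1 - e) \<le> 1/4" by simp
    then have "(e * (1 - e))\<^sup>2 \<le> (1/4)\<^sup>2" using e by (intro power_mono) auto
    then have "e ^ 4 * (e * (1 - e))\<^sup>2 \<le> e ^ 4 * (1/4)\<^sup>2" using e by (intro mult_left_mono) auto
    moreover have "x\<^sup>2 = e ^ 4 * (e * (1 - e))\<^sup>2" unfolding x_def by algebra
    ultimately show ?thesis by (simp add: power2_eq_square)
  qed
  have K0: "62/100 * e ^ 4 - 9/16 * x\<^sup>2 \<le> K" using \<gamma> e by (simp add: K_def mult_right_mono)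
  have "0 \<le> e ^ 4" using e by simp
  then have K: "0 \<le> K" using K0 x2 by linarith
  \<comment> \<open>As K >= 0, B may be replaced by T / (2 + x), which leaves T as the only
    integral. Up to e = 16/25 it is bounded by the line exact at m = 1, beyond that by the cubic
    exact at m = 0.\<close>
  have main: "(2 + x)\<^sup>2 \<le> T\<^sup>2 * ((2 + x)\<^sup>2 / 4 + K)"
  proof (cases "e \<le> 16/25")
    case True
    have "(2 + x)\<^sup>2 \<le> (2 - e ^ 4 / 2)\<^sup>2 * ((2 + x)\<^sup>2 / 4 + (62/100 * e ^ 4 - 9/16 * x\<^sup>2))"
      using poly_ineq_near_1[of e] True e by (simp add: x_def)
    also have "\<dots> \<le> T\<^sup>2 * ((2 + x)\<^sup>2 / 4 + K)"
    proof (intro mult_mono power_mono add_left_mono K0)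
      show "2 - e ^ 4 / 2 \<le> T" using ellT_ge_linear[of m] assms e(3) by (simp add: T_def)
      show "0 \<le> 2 - e ^ 4 / 2" using power_le_one[of e 4] e by simp
      show "0 \<le> (2 + x)\<^sup>2 / 4 + (62/100 * e ^ 4 - 9/16 * x\<^sup>2)"
        using x2 \<open>0 \<le> e ^ 4\<close> zero_le_power2[of "2 + x"] by linarith
    qed simp
    finally show ?thesis .
  next
    case False
    define p where "p = pi\<^sup>2 / 16"
    have p: "61685/100000 \<le> p" using pi_sq_bounds by (simp add: p_def)
    define \<tau> where "\<tau> = 1 + m / 4 + m\<^sup>2 / 64 + m ^ 3 / 256"
    have p\<gamma>: "p * \<gamma> = 1 - p" by (simp add: p_def \<gamma>_def field_simps)
    have "(2 + x)\<^sup>2 \<le> \<tau>\<^sup>2 * (4 * (p * ((2 + x)\<^sup>2 / 4 - 9/16 * x\<^sup>2 - e ^ 4) + e ^ 4))"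
      using poly_ineq_near_0[of e p] False e(1,2) p unfolding e(3) \<tau>_def x_def by simp
    also have "p * ((2 + x)\<^sup>2 / 4 - 9/16 * x\<^sup>2 - e ^ 4) + e ^ 4 = p * ((2 + x)\<^sup>2 / 4 - 9/16 * x\<^sup>2) + p * \<gamma> * e ^ 4"
      unfolding p\<gamma> by (simp add: algebra_simps)
    also have "\<tau>\<^sup>2 * (4 * (p * ((2 + x)\<^sup>2 / 4 - 9/16 * x\<^sup>2) + p * \<gamma> * e ^ 4)) = (pi / 2 * \<tau>)\<^sup>2 * ((2 + x)\<^sup>2 / 4 + K)"
      by (simp add: K_def p_def power2_eq_square algebra_simps)
    also have "\<dots> \<le> T\<^sup>2 * ((2 + x)\<^sup>2 / 4 + K)"
      using ellT_ge_cubic[of m] assms K by (intro mult_right_mono power_mono) (auto simp: T_def \<tau>_def)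
    finally show ?thesis .
  qed
  have "T\<^sup>2 \<le> ((2 + x) * B)\<^sup>2" using TB T B by (intro power_mono) auto
  then have "T\<^sup>2 * K \<le> ((2 + x) * B)\<^sup>2 * K" using K by (rule mult_right_mono)
  then have "T\<^sup>2 * K \<le> (2 + x)\<^sup>2 * (B\<^sup>2 * K)" by (simp only: power_mult_distrib mult.assoc)
  moreover have "T\<^sup>2 * ((2 + x)\<^sup>2 / 4 + K) = (2 + x)\<^sup>2 * (T\<^sup>2 / 4) + T\<^sup>2 * K"
    by (simp add: algebra_simps)
  ultimately have "(2 + x)\<^sup>2 * 1 \<le> (2 + x)\<^sup>2 * (T\<^sup>2 / 4 + B\<^sup>2 * K)"
    using main unfolding distrib_left by linarith
  then have "1 \<le> T\<^sup>2 / 4 + B\<^sup>2 * K" using x by (simp only: mult_le_cancel_left_pos zero_less_power add_pos_nonneg zero_less_numeral)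
  moreover have "(T / 2 - B)\<^sup>2 \<le> (x * B / 2)\<^sup>2"
    using TB T by (intro power_mono) (auto simp: algebra_simps)
  ultimately have "1 - T\<^sup>2 / 4 + 9/4 * (T / 2 - B)\<^sup>2 \<le> B\<^sup>2 * K + 9/16 * (x * B)\<^sup>2"
    by (simp add: power_divide)
  also have "\<dots> = \<gamma> * ((1 - m) * B\<^sup>2)"
    by (simp add: K_def e(3) power_mult_distrib algebra_simps)
  finally show ?thesis by (simp add: B_def T_def \<gamma>_def)
qed

text \<open>The difference vanishes at m = 1 and increases, by T >= 2 B and B' >= 0. It bounds the
  variance part of the barrier from below.\<close>

lemma ellT_sq_upper:
  assumes "0 \<le> m" "m \<le> 1"
  shows "(1 - m) * (ellB m)\<^sup>2 / 2 \<le> 1 - (ellT m)\<^sup>2 / 4"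
proof -
  let ?f = "\<lambda>x. (1 - x) * (ellB x)\<^sup>2 / 2 - (1 - (ellT x)\<^sup>2 / 4)"
  have "?f m \<le> ?f 1"
  proof (rule DERIV_nonneg_imp_increasing_open[where f = ?f])
    fix x assume x: "m < x" "x < 1"
    then have x01: "0 < x" "x < 1" using assms by auto
    define B C T r where "B = ellB x" and "C = ellC x" and "T = ellT x" and "r = (C - B) / (2 * x)"
    have d: "(ellB has_real_derivative r) (at x)" "(ellT has_real_derivative B / 2) (at x)"
      using ellB_deriv[OF x01] ellT_deriv[OF x01] by (auto simp: B_def C_def r_def)
    have "(?f has_real_derivative (1 - x) * B * r - B\<^sup>2 / 2 + T * B / 4) (at x)"
      by (auto intro!: derivative_eq_intros d simp: B_def[symmetric] T_def[symmetric] power2_eq_square field_simps)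
    moreover have "0 \<le> (1 - x) * B * r - B\<^sup>2 / 2 + T * B / 4"
    proof -
      have "0 < B" "2 * B \<le> T" "B \<le> C" using ellB_pos[of x] ellT_ge_2_ellB[of x] ellB_le_ellC[of x] x01
        by (auto simp: B_def C_def T_def)
      then have "0 \<le> r" "2 * B * B \<le> T * B" using x01 by (auto simp: r_def)
      moreover have "0 \<le> (1 - x) * B * r" using \<open>0 \<le> r\<close> x01 \<open>0 < B\<close> by simp
      ultimately show ?thesis by (simp add: power2_eq_square)
    qed
    ultimately show "\<exists>y. (?f has_real_derivative y) (at x) \<and> 0 \<le> y" by blast
  next
    show "continuous_on {m..1} ?f"
      using assms by (intro continuous_intros continuous_on_subset[OF continuous_on_ellB]
          continuous_on_subset[OF continuous_on_ellT]) auto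
  qed (use assms in auto)
  then show ?thesis by (simp add: ellT_1)
qed

text \<open>The derivative is - B (B - (1 - m) C) / m. Thus the variance bounds of the invariant
  regions are nested.\<close>

lemma one_minus_ellB_sq_antimono:
  assumes "0 \<le> m" "m \<le> n" "n \<le> 1"
  shows "(1 - n) * (ellB n)\<^sup>2 \<le> (1 - m) * (ellB m)\<^sup>2"
proof -
  let ?f = "\<lambda>x. - ((1 - x) * (ellB x)\<^sup>2)"
  have "?f m \<le> ?f n"
  proof (rule DERIV_nonneg_imp_increasing_open[where f = ?f])
    fix x assume x: "m < x" "x < n"
    then have x01: "0 < x" "x < 1" using assms by auto
    define B C r where "B = ellB x" and "C = ellC x" and "r = (C - B) / (2 * x)"
    have d: "(ellB has_real_derivative r) (at x)"
      using ellB_deriv[OF x01] by (auto simp: B_def C_def r_def)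
    have "(?f has_real_derivative B * (B - 2 * (1 - x) * r)) (at x)"
      by (auto intro!: derivative_eq_intros d simp: B_def[symmetric] power2_eq_square algebra_simps)
    moreover have "B - 2 * (1 - x) * r = (B - (1 - x) * C) / x"
      using x01 by (simp add: r_def field_simps)
    moreover have "0 \<le> B" "(1 - x) * C \<le> B" using ellB_pos[of x] mult_one_minus_ellC_le_ellB[of x] x01
        by (auto simp: B_def C_def)
    ultimately show "\<exists>y. (?f has_real_derivative y) (at x) \<and> 0 \<le> y" using x01 by auto
  next
    show "continuous_on {m..n} ?f"
      using assms by (intro continuous_intros continuous_on_subset[OF continuous_on_ellB]) auto
  qed (use assms in auto)
  then show ?thesis by simp
qed

text \<open>With \<open>g = \<delta> / 4\<close>, this is the least value of \<open>\<bar>\<alpha>\<bar>\<^sup>2 + \<sigma>\<^sup>2\<close> that can follow a state with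
  \<open>\<bar>\<alpha>\<bar>\<^sup>2 / (\<bar>\<alpha>\<bar>\<^sup>2 + \<sigma>\<^sup>2) = m\<close>.\<close>

definition barrier :: "real \<Rightarrow> real \<Rightarrow> real" where
  "barrier g m = m * (ellB m)\<^sup>2 + (1 - (ellT m)\<^sup>2 / 4) / g"

lemma continuous_on_barrier: "g \<noteq> 0 \<Longrightarrow> continuous_on {0..1} (barrier g)"
  unfolding barrier_def by (intro continuous_intros continuous_on_ellB continuous_on_ellT) auto

text \<open>The derivative is B (C - T / (4 g)), and B <= C gives T <= 2 C; this is where g > 1/2
  enters.\<close>

lemma barrier_strict_mono:
  assumes g: "1/2 < g" and "0 \<le> m" "m < n" "n \<le> 1"
  shows "barrier g m < barrier g n"
proof (rule DERIV_pos_imp_increasing_open[OF assms(3)])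
  fix x assume x: "m < x" "x < n"
  then have x01: "0 < x" "x < 1" using assms by auto
  define B C T r where "B = ellB x" and "C = ellC x" and "T = ellT x" and "r = (C - B) / (2 * x)"
  have d: "(ellB has_real_derivative r) (at x)" "(ellT has_real_derivative B / 2) (at x)"
    using ellB_deriv[OF x01] ellT_deriv[OF x01] by (auto simp: B_def C_def r_def)
  have "(barrier g has_real_derivative B * (B + 2 * x * r - T / (4 * g))) (at x)"
    unfolding barrier_def using g
    by (auto intro!: derivative_eq_intros d simp: B_def[symmetric] T_def[symmetric] power2_eq_square field_simps)
  moreover have "B + 2 * x * r = C" using x01 by (simp add: r_def)
  moreover have "0 < B" "B \<le> C" using ellB_pos[of x] ellB_le_ellC[of x] x01 by (auto simp: B_def C_def)
  moreover have "T / (4 * g) < C"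
  proof -
    have "T = (1 + x) * B + (1 - x) * C" using ellT_eq[of x] x01 by (simp add: B_def C_def T_def)
    also have "\<dots> \<le> (1 + x) * C + (1 - x) * C" using x01 \<open>B \<le> C\<close> by simp
    also have "\<dots> = 2 * C" by (simp add: algebra_simps)
    also have "\<dots> < 4 * g * C" using g \<open>0 < B\<close> \<open>B \<le> C\<close> by simp
    finally show ?thesis using g by (simp add: field_simps)
  qed
  ultimately show "\<exists>y. (barrier g has_real_derivative y) (at x) \<and> 0 < y" by auto
qed (use assms in \<open>auto intro: continuous_on_subset[OF continuous_on_barrier]\<close>)

lemma barrier_mono: "1/2 < g \<Longrightarrow> 0 \<le> m \<Longrightarrow> m \<le> n \<Longrightarrow> n \<le> 1 \<Longrightarrow> barrier g m \<le> barrier g n"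
  using barrier_strict_mono[of g m n] by (cases "m = n") auto

section \<open>The variance update\<close>

lemma quadratic_neg_between:
  fixes b c x y z :: real
  assumes "x \<le> z" "z \<le> y" "x\<^sup>2 - b * x + c < 0" "y\<^sup>2 - b * y + c < 0"
  shows "z\<^sup>2 - b * z + c < 0"
proof (cases "2 * z \<le> b")
  case True
  have "0 \<le> (z - x) * (b - z - x)" using True assms(1) by (intro mult_nonneg_nonneg) auto
  then have "z\<^sup>2 - b * z \<le> x\<^sup>2 - b * x" by (simp add: power2_eq_square algebra_simps)
  then show ?thesis using assms(3) by simp
next
  case False
  have "0 \<le> (y - z) * (y + z - b)" using False assms(2) by (intro mult_nonneg_nonneg) auto
  then have "z\<^sup>2 - b * z \<le> y\<^sup>2 - b * y" by (simp add: power2_eq_square algebra_simps)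
  then show ?thesis using assms(4) by simp
qed

text \<open>Read m l^2 as |\<alpha>|^2 and (1 - m) l^2 as the variance. If l >= (3 + m) / 2, the
  variance bound fails for m <= 36/100 and the bound on |\<alpha>| for larger m. The conclusion
  gives l^2 - l T <= 0, which preserves the variance bound 1 / g.\<close>

lemma less_ellT:
  assumes "0 \<le> m" "m \<le> 1" "0 \<le> l" "m * l\<^sup>2 \<le> 1" "62/100 * ((1 - m) * l\<^sup>2) \<le> 1"
  shows "l < ellT m"
proof (rule ccontr)
  assume "\<not> l < ellT m"
  then have "(3 + m) / 2 \<le> l" using ellT_ge_linear[OF assms(1,2)] by simp
  then have "((3 + m) / 2)\<^sup>2 \<le> l\<^sup>2" using assms by (intro power_mono) auto
  then have l: "9 + 6 * m + m\<^sup>2 \<le> 4 * l\<^sup>2" by (simp add: power2_eq_square algebra_simps)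
  show False
  proof (cases "m \<le> 36/100")
    case True
    have "m\<^sup>2 \<le> (36/100)\<^sup>2" "m ^ 3 \<le> (36/100) ^ 3" using True assms by (auto intro: power_mono)
    then have "7 \<le> (1 - m) * (9 + 6 * m + m\<^sup>2)"
      using True by (simp add: power2_eq_square power3_eq_cube algebra_simps)
    also have "\<dots> \<le> (1 - m) * (4 * l\<^sup>2)" using l assms by (intro mult_left_mono) auto
    finally show False using assms(5) by simp
  next
    case False
    have "36/100 * (9 + 6 * (36/100) + (36/100)\<^sup>2) \<le> m * (9 + 6 * m + m\<^sup>2)"
      using False assms by (intro mult_mono add_mono power_mono) auto
    also have "\<dots> \<le> m * (4 * l\<^sup>2)" using l assms by (intro mult_left_mono) auto
    also have "\<dots> \<le> 4" using assms(4) by simp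
    finally show False by (simp add: power2_eq_square)
  qed
qed

text \<open>The case l = B(m) of a stationary |\<alpha>|: completing the square leaves (T / 2 - B)^2
  with coefficient 1.\<close>

lemma ellB_sq_less:
  assumes "0 \<le> m" "m < 1" "16 / pi\<^sup>2 - 1 < g"
  shows "(ellB m)\<^sup>2 + 1 - ellB m * ellT m < g * ((1 - m) * (ellB m)\<^sup>2)"
proof -
  have "(ellB m)\<^sup>2 + 1 - ellB m * ellT m = 1 - (ellT m)\<^sup>2 / 4 + (ellT m / 2 - ellB m)\<^sup>2"
    by (simp add: power2_eq_square field_simps)
  also have "\<dots> \<le> 1 - (ellT m)\<^sup>2 / 4 + 9/4 * (ellT m / 2 - ellB m)\<^sup>2" by simp
  also have "\<dots> \<le> (16 / pi\<^sup>2 - 1) * ((1 - m) * (ellB m)\<^sup>2)" using threshold_inequality assms by simp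
  also have "\<dots> < g * ((1 - m) * (ellB m)\<^sup>2)"
    using assms ellB_pos[of m] by (intro mult_strict_right_mono) auto
  finally show ?thesis .
qed

text \<open>After division by l^2 a convex quadratic has to be negative at z = 1 / l. It is so at 1
  / B, by \<open>ellB_sq_less\<close>, and a second such point is needed below z.\<close>

lemma variance_decreases:
  assumes m: "0 \<le> m" "m < 1" and g: "16 / pi\<^sup>2 - 1 < g"
    and l: "ellB m \<le> l" "m * l\<^sup>2 \<le> 1" "g * ((1 - m) * l\<^sup>2) \<le> 1"
  shows "l\<^sup>2 + 1 - l * ellT m < g * ((1 - m) * l\<^sup>2)"
proof -
  have g62: "62/100 < g" using g threshold_bounds by simp
  define B T where "B = ellB m" and "T = ellT m"
  have B: "0 < B" using ellB_pos m by (simp add: B_def)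
  have l0: "0 < l" using B l(1) by (simp add: B_def)
  define q where "q = g * (1 - m)"
  have q: "0 < q" using g62 m by (simp add: q_def)
  define z where "z = 1 / l"
  have z: "0 < z" "z \<le> 1 / B" "z\<^sup>2 * l\<^sup>2 = 1" using l0 l(1) B by (auto simp: z_def B_def frac_le power_divide)
  have zm: "m \<le> z\<^sup>2" "q \<le> z\<^sup>2"
    using l(2,3) l0 by (auto simp: z_def power_divide q_def field_simps)
  have right: "(1 / B)\<^sup>2 - T * (1 / B) + (1 - q) < 0"
  proof -
    have "B\<^sup>2 + 1 - B * T - q * B\<^sup>2 < 0"
      using ellB_sq_less[OF m g] by (simp add: B_def T_def q_def mult.assoc)
    then have "(B\<^sup>2 + 1 - B * T - q * B\<^sup>2) / B\<^sup>2 < 0" using B by (intro divide_neg_pos) auto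
    then show ?thesis using B by (simp add: field_simps power2_eq_square)
  qed
  \<comment> \<open>The bounds on |\<alpha>| and the variance say z^2 >= m and z^2 >= q; the root of
    the larger one serves as x.\<close>
  have "\<exists>x. x \<le> z \<and> x\<^sup>2 - T * x + (1 - q) < 0"
  proof (cases "m \<le> q")
    case True
    define x where "x = sqrt q"
    have x: "0 < x" "x\<^sup>2 = q" using q by (auto simp: x_def)
    have "1 / x < T" unfolding T_def
    proof (rule less_ellT)
      show "m * (1 / x)\<^sup>2 \<le> 1" using True x q by (simp add: power_divide)
      have "62/100 * (1 - m) \<le> q" unfolding q_def using g62 m by (intro mult_right_mono) auto
      then show "62/100 * ((1 - m) * (1 / x)\<^sup>2) \<le> 1" using x q by (simp add: power_divide field_simps)
    qed (use x m in auto)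
    then have "1 < T * x" using x by (simp add: field_simps)
    moreover have "x \<le> z" using zm(2) z(1) x by (metis less_imp_le power2_le_imp_le)
    ultimately show ?thesis using x by (intro exI[of _ x]) auto
  next
    case False
    define x where "x = sqrt m"
    have "62/100 * (1 - m) < m"
      using False mult_right_mono[of "62/100" g "1 - m"] g62 m by (simp add: q_def)
    then have m38: "38/100 < m" by simp
    have x: "0 \<le> x" "x\<^sup>2 = m" using m by (auto simp: x_def)
    have x1: "61/100 < x" "x < 1"
    proof -
      have "(61/100)\<^sup>2 < x\<^sup>2" "x\<^sup>2 < 1\<^sup>2" using m38 x m by (auto simp: power2_eq_square)
      then show "61/100 < x" "x < 1" using x power2_less_imp_less[of "61/100" x] power2_less_imp_less[of x 1] by auto
    qed
    have "x * ((3 + x\<^sup>2) / 2) \<le> x * T"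
      using ellT_ge_linear[of m] m x by (intro mult_left_mono) (auto simp: T_def)
    moreover have "62/100 * (1 - x\<^sup>2) \<le> q"
      unfolding q_def x(2) using g62 m by (intro mult_right_mono) auto
    \<comment> \<open>The factor 1 - x reflects the fixed point m = l = 1, where equality
      holds.\<close>
    moreover have "x\<^sup>2 + 1 - x * ((3 + x\<^sup>2) / 2) - 62/100 * (1 - x\<^sup>2)
       = - ((1 - x) * ((112/100 - x/2) * x - 38/100))"
      by (simp add: field_simps power2_eq_square)
    moreover have "0 < (1 - x) * ((112/100 - x/2) * x - 38/100)"
    proof (rule mult_pos_pos)
      have "0 < (x - 61/100) * (1 - x)" using x1 by simp
      moreover have "(x - 61/100) * (1 - x) = 161/100 * x - 61/100 - x * x" by (simp add: field_simps)
      ultimately have "x * x < 161/100 * x - 61/100" by linarith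
      moreover have "(112/100 - x/2) * x - 38/100 = 112/100 * x - x * x / 2 - 38/100"
        by (simp add: algebra_simps)
      ultimately show "0 < (112/100 - x/2) * x - 38/100" using x1(1) by linarith
    qed (use x1 in auto)
    ultimately have "x\<^sup>2 - x * T + (1 - q) < 0" by linarith
    then have "x\<^sup>2 - T * x + (1 - q) < 0" by (simp only: mult.commute)
    moreover have "x \<le> z" using zm(1) z(1) x by (metis less_imp_le power2_le_imp_le)
    ultimately show ?thesis by blast
  qed
  then obtain x where "x \<le> z" "x\<^sup>2 - T * x + (1 - q) < 0" by blast
  then have "z\<^sup>2 - T * z + (1 - q) < 0" using quadratic_neg_between[OF _ z(2) _ right] by blast
  then have "(z\<^sup>2 - T * z + (1 - q)) * l\<^sup>2 < 0" using l0 by (intro mult_neg_pos) auto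
  moreover have "(z\<^sup>2 - T * z + (1 - q)) * l\<^sup>2 = l\<^sup>2 + 1 - l * T - q * l\<^sup>2"
    using l0 by (simp add: z_def field_simps power2_eq_square)
  ultimately show ?thesis by (simp add: q_def T_def mult.assoc)
qed

text \<open>At the threshold value of \<open>g\<close>, write \<open>T/2 - L = (T/2 - B) + (B - L)\<close>: the first part is controlled by
  the factor \<open>9/4\<close> in the threshold inequality, the second by \<open>(B - L) (B + L) = u\<close>.\<close>

lemma barrier_critical:
  assumes m: "0 \<le> m" "m < 1"
  defines "\<gamma> \<equiv> 16 / pi\<^sup>2 - 1"
  defines "L \<equiv> sqrt (barrier \<gamma> m)"
  shows "L\<^sup>2 = barrier \<gamma> m" "L \<le> ellB m" "L\<^sup>2 + 1 - L * ellT m \<le> \<gamma> * ((1 - m) * (ellB m)\<^sup>2)"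
proof -
  define B T k P u d where "B = ellB m" and "T = ellT m" and "k = 1 - T\<^sup>2 / 4"
    and "P = (1 - m) * B\<^sup>2" and "u = P - k / \<gamma>" and "d = T / 2 - B"
  have \<gamma>: "62/100 \<le> \<gamma>" "\<gamma> \<le> 625/1000" using threshold_bounds by (auto simp: \<gamma>_def)
  have B: "0 < B" using ellB_pos m by (simp add: B_def)
  have d: "0 \<le> d" using ellT_ge_2_ellB[of m] m by (simp add: d_def B_def T_def)
  have key: "k + 9/4 * d\<^sup>2 \<le> \<gamma> * P"
    using threshold_inequality[OF m] by (simp add: k_def d_def P_def B_def T_def \<gamma>_def)
  have kP: "P / 2 \<le> k" using ellT_sq_upper[of m] m by (simp add: P_def k_def B_def T_def)
  have P: "0 \<le> P" "P \<le> B\<^sup>2" using m B by (auto simp: P_def mult_left_le_one_le)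
  have \<gamma>u: "\<gamma> * u = \<gamma> * P - k" using \<gamma> by (simp add: u_def field_simps)
  then have du: "9/4 * d\<^sup>2 \<le> \<gamma> * u" using key by simp
  then have "0 \<le> \<gamma> * u" using zero_le_power2[of d] by linarith
  then have u0: "0 \<le> u" using \<gamma> by (simp add: zero_le_mult_iff)
  have u: "u \<le> B\<^sup>2 / 5"
  proof -
    \<comment> \<open>8/5 is the reciprocal of the upper bound 625/1000 for
      \<open>\<gamma>\<close>.\<close>
    have "P / 2 * (8/5) \<le> k * (1 / \<gamma>)" using kP P \<gamma> by (intro mult_mono) (auto simp: field_simps)
    then show ?thesis using P by (simp add: u_def)
  qed
  have Lb: "barrier \<gamma> m = B\<^sup>2 - u" by (simp add: barrier_def u_def P_def k_def B_def T_def algebra_simps)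
  have "0 \<le> B\<^sup>2 - u" using u u0 by linarith
  then have L2: "L\<^sup>2 = B\<^sup>2 - u" using Lb by (simp add: L_def)
  then show "L\<^sup>2 = barrier \<gamma> m" using Lb by simp
  have L0: "0 \<le> L" unfolding L_def Lb by (rule real_sqrt_ge_zero) (use u u0 in linarith)
  have "L\<^sup>2 \<le> B\<^sup>2" using L2 u0 by simp
  then have LB: "L \<le> B" by (rule power2_le_imp_le) (use B in simp)
  then show "L \<le> ellB m" by (simp add: B_def)
  have "(T / 2 - L)\<^sup>2 \<le> \<gamma> * u"
  proof -
    have "u = (B - L) * (B + L)" using L2 by (simp add: power2_eq_square algebra_simps)
    have "9 * (B - L)\<^sup>2 \<le> \<gamma> * u"
    proof -
      have "L * L \<le> B * L" using LB L0 by (rule mult_right_mono)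
      then have BL: "B\<^sup>2 + 3 * L\<^sup>2 \<le> (B + L)\<^sup>2" by (simp add: power2_eq_square algebra_simps)
      have "(62/100) * (B\<^sup>2 + 3 * L\<^sup>2) \<le> \<gamma> * (B + L)\<^sup>2" using \<gamma> BL by (intro mult_mono) auto
      moreover have "9 * u \<le> (62/100) * (B\<^sup>2 + 3 * L\<^sup>2)" using u u0 unfolding L2 by simp
      ultimately have "9 * u \<le> \<gamma> * (B + L)\<^sup>2" by (rule order_trans[rotated])
      then have "u * (9 * u) \<le> u * (\<gamma> * (B + L)\<^sup>2)" using u0 by (rule mult_left_mono)
      moreover have "u * (9 * u) = (9 * (B - L)\<^sup>2) * (B + L)\<^sup>2"
        by (subst (1 2) \<open>u = (B - L) * (B + L)\<close>) (simp add: power2_eq_square)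
      ultimately have "(9 * (B - L)\<^sup>2) * (B + L)\<^sup>2 \<le> (\<gamma> * u) * (B + L)\<^sup>2" by (simp add: mult_ac)
      then show ?thesis using B L0 by (simp add: mult_le_cancel_right)
    qed
    \<comment> \<open>The weights make the two terms at most 2/3 and 1/3 of
      \<open>\<gamma> * u\<close>.\<close>
    moreover have "(d + (B - L))\<^sup>2 \<le> 3/2 * d\<^sup>2 + 3 * (B - L)\<^sup>2"
    proof -
      have "0 \<le> (d - 2 * (B - L))\<^sup>2 / 2" by simp
      then show ?thesis by (simp add: power2_eq_square algebra_simps)
    qed
    ultimately show ?thesis using du by (simp add: d_def)
  qed
  moreover have "L\<^sup>2 + 1 - L * T = (T / 2 - L)\<^sup>2 + k" by (simp add: k_def power2_eq_square field_simps)
  ultimately show "L\<^sup>2 + 1 - L * ellT m \<le> \<gamma> * ((1 - m) * (ellB m)\<^sup>2)"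
    using \<gamma>u by (simp add: P_def B_def T_def)
qed

text \<open>\<open>(L\<^sup>2 - m B\<^sup>2) (L\<^sup>2 + 1 - L T)\<close> is increasing in \<open>L\<close>, which transfers the critical case to larger \<open>g\<close>.\<close>

lemma barrier_less:
  assumes m: "0 \<le> m" "m < 1" and g: "16 / pi\<^sup>2 - 1 < g"
  defines "L \<equiv> sqrt (barrier g m)"
  shows "L\<^sup>2 = barrier g m" "0 \<le> L" "L \<le> ellB m" "L\<^sup>2 + 1 - L * ellT m < g * ((1 - m) * (ellB m)\<^sup>2)"
proof -
  define \<gamma> L0 where "\<gamma> = 16 / pi\<^sup>2 - 1" and "L0 = sqrt (barrier \<gamma> m)"
  define B T k P A A0 where "B = ellB m" and "T = ellT m" and "k = 1 - T\<^sup>2 / 4"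
    and "P = (1 - m) * B\<^sup>2" and "A = k / g" and "A0 = k / \<gamma>"
  have \<gamma>: "62/100 \<le> \<gamma>" "\<gamma> < g" using threshold_bounds g by (auto simp: \<gamma>_def)
  have B: "0 < B" using ellB_pos m by (simp add: B_def)
  have "(pi / 4)\<^sup>2 \<le> B\<^sup>2" using ellB_ge[of m] m by (intro power_mono) (auto simp: B_def)
  then have B2: "1/2 < B\<^sup>2" using pi_sq_bounds by (simp add: power_divide)
  have kP: "P / 2 \<le> k" using ellT_sq_upper[of m] m by (simp add: P_def k_def B_def T_def)
  have "0 < P" using m B by (simp add: P_def)
  with kP have k: "0 < k" by simp
  have crit: "L0\<^sup>2 = barrier \<gamma> m" "L0 \<le> B" "L0\<^sup>2 + 1 - L0 * T \<le> \<gamma> * P"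
    using barrier_critical[OF m] by (auto simp: L0_def \<gamma>_def B_def T_def P_def)
  \<comment> \<open>The product k of g and A is the same for both values of g, so the claim
    multiplied by A can be compared with the critical one multiplied by A0.\<close>
  have A: "0 < A" "A < A0" "g * A = k" "\<gamma> * A0 = k"
    using k \<gamma> by (auto simp: A_def A0_def frac_less2)
  have b: "barrier g m = m * B\<^sup>2 + A" "L0\<^sup>2 = m * B\<^sup>2 + A0"
    using crit(1) by (auto simp: barrier_def A_def A0_def k_def B_def T_def)
  then have "0 < barrier g m" "barrier g m < L0\<^sup>2" using A m by (auto simp: add_nonneg_pos)
  then have L: "L\<^sup>2 = m * B\<^sup>2 + A" "0 < L" "L\<^sup>2 < L0\<^sup>2" using b by (auto simp: L_def)
  have L00: "0 \<le> L0" using crit(1) b A m by (auto simp: L0_def)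
  have LL0: "L < L0" using L(3) L00 by (rule power2_less_imp_less)
  show "L\<^sup>2 = barrier g m" using L(1) b(1) by simp
  show "0 \<le> L" using L(2) by simp
  show "L \<le> ellB m" using LL0 crit(2) by (simp add: B_def)
  define y where "y = T - L0"
  have y: "0 < y" "L < y" using ellT_ge_2_ellB[of m] m crit(2) LL0 B L(2) by (auto simp: y_def B_def T_def)
  define G0 where "G0 = L0\<^sup>2 + 1 - L0 * T"
  \<comment> \<open>Since T = L0 + y, G0 = 1 - L0 y is a square plus k y^2, and k exceeds (1 - m) /
    8.\<close>
  have G0: "(1 - m) * (y\<^sup>2 / 8) < G0"
  proof -
    have "(1 - m) * 1 \<le> (1 - m) * (2 * B\<^sup>2)" using B2 m by (intro mult_left_mono) auto
    also have "\<dots> = 2 * P" by (simp add: P_def)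
    finally have "(1 - m) / 8 < k" using kP k by linarith
    then have "0 < (k - (1 - m) / 8) * y\<^sup>2" using y by simp
    moreover have "G0 = (1 - T * y / 2)\<^sup>2 + k * y\<^sup>2"
      by (simp add: G0_def k_def y_def power2_eq_square field_simps)
    moreover have "0 \<le> (1 - T * y / 2)\<^sup>2" by simp
    ultimately show ?thesis by (simp only: left_diff_distrib times_divide_eq_left times_divide_eq_right)
  qed
  \<comment> \<open>This is the growth of the product from L to L0 with the factor L0 - L split
    off.\<close>
  have "A * (y - L) < (L + L0) * G0"
  proof -
    have "m * L\<^sup>2 \<le> m * B\<^sup>2" using crit(2) LL0 L(2) m by (intro mult_left_mono power_mono) auto
    then have "A \<le> (1 - m) * L\<^sup>2" using L(1) by (simp add: algebra_simps)
    then have "A * (y - L) \<le> ((1 - m) * L\<^sup>2) * (y - L)" using y by (intro mult_right_mono) auto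
    also have "\<dots> = (1 - m) * L * (L * (y - L))" by (simp add: power2_eq_square)
    also have "\<dots> \<le> (1 - m) * L * (y\<^sup>2 / 4)"
    proof (rule mult_left_mono)
      have "0 \<le> (y / 2 - L)\<^sup>2" by simp
      then show "L * (y - L) \<le> y\<^sup>2 / 4" by (simp add: power2_eq_square algebra_simps)
    qed (use m L in auto)
    also have "\<dots> = (L + L) * ((1 - m) * (y\<^sup>2 / 8))" by simp
    also have "\<dots> \<le> (L + L0) * ((1 - m) * (y\<^sup>2 / 8))"
      using LL0 m by (intro mult_right_mono) auto
    also have "\<dots> < (L + L0) * G0" using G0 L(2) LL0 by (intro mult_strict_left_mono) auto
    finally show ?thesis .
  qed
  then have "0 < (L0 - L) * ((L + L0) * G0 - A * (y - L))" using LL0 by simp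
  also have "\<dots> = (L0\<^sup>2 - L\<^sup>2) * G0 - A * ((L0 - L) * (T - L0 - L))"
    by (simp add: y_def power2_eq_square algebra_simps)
  also have "\<dots> = A0 * G0 - A * (L\<^sup>2 + 1 - L * T)"
  proof -
    have "L0\<^sup>2 - L\<^sup>2 = A0 - A" using L(1) b(2) by simp
    moreover have "(L0 - L) * (T - L0 - L) = (L\<^sup>2 + 1 - L * T) - G0"
      by (simp add: G0_def power2_eq_square algebra_simps)
    ultimately show ?thesis by (simp only:) (simp only: left_diff_distrib right_diff_distrib)
  qed
  finally have "A * (L\<^sup>2 + 1 - L * T) < A0 * G0" by simp
  also have "\<dots> \<le> A0 * (\<gamma> * P)" using crit(3) A by (intro mult_left_mono) (auto simp: G0_def)
  also have "\<dots> = A * (g * P)" by (simp only: mult.assoc[symmetric] mult.commute[of A0] mult.commute[of A] A(3,4))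
  finally show "L\<^sup>2 + 1 - L * ellT m < g * ((1 - m) * (ellB m)\<^sup>2)" using A(1) by (simp add: P_def B_def T_def)
qed

text \<open>For l >= B(m) the variance decreases from a value already below the level. For smaller
  l, T(m) may be lowered: to T(n) if l <= B(n), where a convex quadratic in l is negative at both
  L(n) and B(n); otherwise to T(p) with B(p) = l, which is a point of the stationary curve whose
  level is lower than that of n.\<close>

lemma variance_below_barrier_level:
  assumes n: "0 \<le> n" "n < 1" and m: "n \<le> m" "m \<le> 1" and g: "16 / pi\<^sup>2 - 1 < g"
    and l: "0 \<le> l" "barrier g n \<le> l\<^sup>2" "m * l\<^sup>2 \<le> 1" "g * ((1 - m) * l\<^sup>2) \<le> 1"
    and s: "(1 - m) * l\<^sup>2 \<le> (1 - n) * (ellB n)\<^sup>2"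
  shows "l\<^sup>2 + 1 - l * ellT m < g * ((1 - n) * (ellB n)\<^sup>2)"
proof -
  have g0: "0 < g" using g threshold_bounds by simp
  have Pn: "0 < (1 - n) * (ellB n)\<^sup>2" using n ellB_pos[of n] by simp
  consider "ellB m \<le> l" | "l < ellB m" "l \<le> ellB n" | "l < ellB m" "ellB n < l" by linarith
  then show ?thesis
  proof cases
    case 1
    show ?thesis
    proof (cases "m = 1")
      case True
      with 1 l(1,3) have "l = 1" by (simp add: ellB_1 power_le_one_iff)
      then show ?thesis using True Pn g0 by (simp add: ellT_1)
    next
      case False
      then have "l\<^sup>2 + 1 - l * ellT m < g * ((1 - m) * l\<^sup>2)"
        using variance_decreases[of m g l] 1 l m n g by auto
      also have "\<dots> \<le> g * ((1 - n) * (ellB n)\<^sup>2)" using s g0 by (intro mult_left_mono) auto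
      finally show ?thesis .
    qed
  next
    case 2
    define L where "L = sqrt (barrier g n)"
    note L = barrier_less[OF n g, folded L_def]
    have "L\<^sup>2 \<le> l\<^sup>2" using L(1) l(2) by simp
    then have "L \<le> l" using l(1) by (rule power2_le_imp_le)
    have "l\<^sup>2 - ellT n * l + (1 - g * ((1 - n) * (ellB n)\<^sup>2)) < 0"
      by (rule quadratic_neg_between[OF \<open>L \<le> l\<close> 2(2)])
        (use L(4) ellB_sq_less[OF n g] in \<open>simp_all add: algebra_simps\<close>)
    moreover have "l * ellT n \<le> l * ellT m" using ellT_mono[of n m] n m l(1) by (intro mult_left_mono) auto
    ultimately show ?thesis by (simp add: algebra_simps)
  next
    case 3
    have "continuous_on {n..m} ellB" using n m by (intro continuous_on_subset[OF continuous_on_ellB]) auto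
    then obtain p where p: "n \<le> p" "p \<le> m" "ellB p = l"
      using IVT'[of ellB n l m] 3 m by auto
    have "p \<noteq> m" using 3(1) p(3) by auto
    then have "p < 1" using p(2) m by simp
    have "l * ellT p \<le> l * ellT m" using ellT_mono[of p m] p n m l(1) by (intro mult_left_mono) auto
    then have "l\<^sup>2 + 1 - l * ellT m \<le> (ellB p)\<^sup>2 + 1 - ellB p * ellT p" using p(3) by simp
    also have "\<dots> < g * ((1 - p) * (ellB p)\<^sup>2)" using ellB_sq_less[of p g] p n \<open>p < 1\<close> g by simp
    also have "\<dots> \<le> g * ((1 - n) * (ellB n)\<^sup>2)"
      using one_minus_ellB_sq_antimono[of n p] p n \<open>p < 1\<close> g0 by (intro mult_left_mono) auto
    finally show ?thesis .
  qed
qed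

section \<open>Orbits of the state evolution\<close>

definition ratio :: "real \<Rightarrow> real \<Rightarrow> real" where
  "ratio r s = r\<^sup>2 / (r\<^sup>2 + s)"

definition next_r :: "real \<Rightarrow> real \<Rightarrow> real" where
  "next_r r s = sqrt (ratio r s) * ellB (ratio r s)"

definition next_s :: "real \<Rightarrow> real \<Rightarrow> real \<Rightarrow> real" where
  "next_s g r s = (r\<^sup>2 + s + 1 - sqrt (r\<^sup>2 + s) * ellT (ratio r s)) / g"

lemma ratio_bounds: "0 \<le> s \<Longrightarrow> 0 \<le> ratio r s" "0 \<le> s \<Longrightarrow> ratio r s \<le> 1"
  by (auto simp: ratio_def divide_le_eq_1 add_nonneg_eq_0_iff less_le)

lemma ratio_pos: "0 < r \<Longrightarrow> 0 \<le> s \<Longrightarrow> 0 < ratio r s"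
  by (simp add: ratio_def add_pos_nonneg)

lemma ratio_mult:
  assumes "0 < r\<^sup>2 + s"
  shows "ratio r s * (r\<^sup>2 + s) = r\<^sup>2" "(1 - ratio r s) * (r\<^sup>2 + s) = s"
  using assms by (auto simp: ratio_def field_simps)

lemma integrand_denom:
  assumes "0 < r\<^sup>2 + s"
  shows "sqrt (r\<^sup>2 * (sin \<theta>)\<^sup>2 + s) = sqrt (r\<^sup>2 + s) * sqrt (1 - ratio r s * (cos \<theta>)\<^sup>2)"
proof -
  have "r\<^sup>2 * (sin \<theta>)\<^sup>2 + s = (r\<^sup>2 + s) - r\<^sup>2 * (cos \<theta>)\<^sup>2"
    by (simp add: sin_squared_eq algebra_simps)
  also have "\<dots> = (r\<^sup>2 + s) - (ratio r s * (r\<^sup>2 + s)) * (cos \<theta>)\<^sup>2" using ratio_mult(1)[OF assms] by simp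
  also have "\<dots> = (r\<^sup>2 + s) * (1 - ratio r s * (cos \<theta>)\<^sup>2)" by (simp add: algebra_simps)
  finally show ?thesis by (simp only: real_sqrt_mult)
qed

lemma cmod_psi1:
  assumes "a \<noteq> 0" "0 \<le> s"
  shows "cmod (psi1 a s) = next_r (cmod a) s"
proof -
  define r m l where "r = cmod a" and "m = ratio r s" and "l = sqrt (r\<^sup>2 + s)"
  have r: "0 < r" using assms by (simp add: r_def)
  then have pos: "0 < r\<^sup>2 + s" using assms by (simp add: add_pos_nonneg)
  have m: "0 \<le> m" "m \<le> 1" using ratio_bounds assms by (auto simp: m_def)
  have "integral {0..pi/2} (\<lambda>\<theta>. r * (sin \<theta>)\<^sup>2 / sqrt (r\<^sup>2 * (sin \<theta>)\<^sup>2 + s))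
     = integral {0..pi/2} (\<lambda>\<theta>. (r / l) * ((sin \<theta>)\<^sup>2 / sqrt (1 - m * (cos \<theta>)\<^sup>2)))"
    by (simp add: integrand_denom[OF pos] l_def m_def)
  also have "\<dots> = (r / l) * ellB m" by (simp only: integral_mult_right ellB_def)
  also have "r / l = sqrt m" using r by (simp add: m_def l_def ratio_def real_sqrt_divide)
  finally have "cmod (psi1 a s) = \<bar>sqrt m * ellB m\<bar>"
    by (simp add: psi1_def norm_mult r_def del: of_real_mult)
  then show ?thesis using m ellB_pos[of m] by (simp add: next_r_def m_def r_def)
qed

lemma psi2_eq_next_s:
  assumes "a \<noteq> 0" "0 \<le> s"
  shows "psi2 a s \<delta> 0 = next_s (\<delta> / 4) (cmod a) s"
proof -
  define r m l where "r = cmod a" and "m = ratio r s" and "l = sqrt (r\<^sup>2 + s)"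
  have r: "0 < r" using assms by (simp add: r_def)
  then have pos: "0 < r\<^sup>2 + s" using assms by (simp add: add_pos_nonneg)
  have m: "0 \<le> m" "m \<le> 1" using ratio_bounds assms by (auto simp: m_def)
  have l: "0 < l" "l * l = r\<^sup>2 + s" using pos by (auto simp: l_def)
  have "(2 * r\<^sup>2 * (sin \<theta>)\<^sup>2 + s) / (l * D) = l * (D + m * ((sin \<theta>)\<^sup>2 / D))"
    if D: "D = sqrt (1 - m * (cos \<theta>)\<^sup>2)" for D \<theta>
  \<comment> \<open>D vanishes only if m = 1 and sin theta = 0; there both sides are 0 because
    division by 0 yields 0.\<close>
  proof (cases "D = 0")
    case False
    have D2: "D * D = 1 - m * (cos \<theta>)\<^sup>2" using mult_cos_sq_le_1[OF m] by (simp add: D)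
    have ml: "m * (l * l) = r\<^sup>2" using ratio_mult(1)[OF pos] l by (simp add: m_def)
    have "l * l * (D * D + m * (sin \<theta>)\<^sup>2) = l * l + m * (l * l) * ((sin \<theta>)\<^sup>2 - (cos \<theta>)\<^sup>2)"
      unfolding D2 by (simp add: algebra_simps)
    also have "\<dots> = 2 * r\<^sup>2 * (sin \<theta>)\<^sup>2 + s"
      unfolding ml unfolding l(2) by (simp add: cos_squared_eq algebra_simps)
    finally show ?thesis using False l(1) by (simp add: field_simps)
  qed simp
  then have "integral {0..pi/2} (\<lambda>\<theta>. (2 * r\<^sup>2 * (sin \<theta>)\<^sup>2 + s) / sqrt (r\<^sup>2 * (sin \<theta>)\<^sup>2 + s))
    = integral {0..pi/2} (\<lambda>\<theta>. l * (sqrt (1 - m * (cos \<theta>)\<^sup>2) + m * ((sin \<theta>)\<^sup>2 / sqrt (1 - m * (cos \<theta>)\<^sup>2))))"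
    by (simp add: integrand_denom[OF pos] l_def m_def)
  also have "\<dots> = l * ellT m"
  proof -
    have "((\<lambda>\<theta>. sqrt (1 - m * (cos \<theta>)\<^sup>2) + m * ((sin \<theta>)\<^sup>2 / sqrt (1 - m * (cos \<theta>)\<^sup>2))) has_integral ellT m) {0..pi/2}"
      unfolding ellT_def
      by (intro has_integral_add has_integral_mult_right has_integral_ellB m integrable_integral integrable_sqrt_denom)
    from has_integral_mult_right[OF this, of l] show ?thesis by (rule integral_unique)
  qed
  finally show ?thesis
    by (simp add: psi2_def next_s_def r_def l_def m_def)
qed

lemma next_r_bounds:
  assumes "0 < r" "0 \<le> s"
  shows "0 < next_r r s" "next_r r s \<le> 1" "(next_r r s)\<^sup>2 = ratio r s * (ellB (ratio r s))\<^sup>2"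
  using ratio_pos[OF assms] ratio_bounds[OF assms(2), of r] ellB_pos[of "ratio r s"] ellB_le_1[of "ratio r s"]
  by (auto simp: next_r_def power_mult_distrib intro!: mult_le_one)

text \<open>Discarding (l - T / 2)^2 makes the bound independent of l.\<close>

lemma next_s_ge:
  assumes "0 < g" "0 \<le> r\<^sup>2 + s"
  shows "(1 - (ellT (ratio r s))\<^sup>2 / 4) / g \<le> next_s g r s"
proof -
  define l T where "l = sqrt (r\<^sup>2 + s)" and "T = ellT (ratio r s)"
  have "r\<^sup>2 + s = l\<^sup>2" using assms(2) by (simp add: l_def)
  moreover have "0 \<le> (l - T / 2)\<^sup>2" by simp
  ultimately have "1 - T\<^sup>2 / 4 \<le> r\<^sup>2 + s + 1 - l * T" by (simp add: power2_eq_square algebra_simps)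
  then show ?thesis using assms(1) by (simp add: next_s_def l_def T_def divide_right_mono)
qed

lemma next_s_nonneg:
  assumes "0 < g" "0 \<le> s"
  shows "0 \<le> next_s g r s"
proof -
  define T where "T = ellT (ratio r s)"
  have "0 \<le> T" "T \<le> 2"
    using ellT_ge_linear[of "ratio r s"] ellT_le_2[of "ratio r s"] ratio_bounds[OF assms(2), of r] by (auto simp: T_def)
  then have "T\<^sup>2 \<le> 2\<^sup>2" by (intro power_mono)
  then have "0 \<le> (1 - T\<^sup>2 / 4) / g" using assms by simp
  also have "\<dots> \<le> next_s g r s" unfolding T_def using assms by (intro next_s_ge) auto
  finally show ?thesis .
qed

lemma next_s_upper:
  assumes "0 < g" "0 \<le> s" "sqrt (r\<^sup>2 + s) \<le> ellT (ratio r s)"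
  shows "g * next_s g r s \<le> 1"
proof -
  have "sqrt (r\<^sup>2 + s) * sqrt (r\<^sup>2 + s) \<le> sqrt (r\<^sup>2 + s) * ellT (ratio r s)"
    using assms by (intro mult_left_mono) auto
  then show ?thesis using assms by (simp add: next_s_def)
qed

lemma tendsto_ratio:
  assumes "(f \<longlongrightarrow> \<rho>) F" "(h \<longlongrightarrow> \<sigma>) F" "\<rho>\<^sup>2 + \<sigma> \<noteq> 0"
  shows "((\<lambda>k. ratio (f k) (h k)) \<longlongrightarrow> ratio \<rho> \<sigma>) F"
  unfolding ratio_def using assms by (intro tendsto_intros)

lemma tendsto_next:
  assumes "(f \<longlongrightarrow> \<rho>) F" "(h \<longlongrightarrow> \<sigma>) F" "0 < \<rho>\<^sup>2 + \<sigma>" "0 \<le> \<sigma>" "\<And>k. 0 \<le> h k" "g \<noteq> 0"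
  shows "((\<lambda>k. next_r (f k) (h k)) \<longlongrightarrow> next_r \<rho> \<sigma>) F"
    and "((\<lambda>k. next_s g (f k) (h k)) \<longlongrightarrow> next_s g \<rho> \<sigma>) F"
proof -
  have m: "((\<lambda>k. ratio (f k) (h k)) \<longlongrightarrow> ratio \<rho> \<sigma>) F" using assms by (intro tendsto_ratio) auto
  have in01: "ratio \<rho> \<sigma> \<in> {0..1}" "\<forall>\<^sub>F k in F. ratio (f k) (h k) \<in> {0..1}"
    using ratio_bounds assms(4,5) by auto
  note B = continuous_on_tendsto_compose[OF continuous_on_ellB m in01]
  note T = continuous_on_tendsto_compose[OF continuous_on_ellT m in01]
  show "((\<lambda>k. next_r (f k) (h k)) \<longlongrightarrow> next_r \<rho> \<sigma>) F"
    unfolding next_r_def by (intro tendsto_intros m B)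
  show "((\<lambda>k. next_s g (f k) (h k)) \<longlongrightarrow> next_s g \<rho> \<sigma>) F"
    unfolding next_s_def by (intro tendsto_intros T assms)
qed

text \<open>A decreasing family of forward invariant regions, shrinking to the fixed point \<open>(1, 0)\<close> as \<open>n\<close> tends to \<open>1\<close>.\<close>

definition trapped :: "real \<Rightarrow> real \<Rightarrow> real \<Rightarrow> real \<Rightarrow> bool" where
  "trapped g n r s \<longleftrightarrow> n \<le> ratio r s \<and> barrier g n \<le> r\<^sup>2 + s \<and> s \<le> (1 - n) * (ellB n)\<^sup>2"

lemma trapped_antimono:
  assumes "1/2 < g" "0 \<le> n'" "n' \<le> n" "n \<le> 1" "trapped g n r s"
  shows "trapped g n' r s"
  using assms barrier_mono[of g n' n] one_minus_ellB_sq_antimono[of n' n] by (auto simp: trapped_def)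

text \<open>The new ratio exceeds n because the new |\<alpha>|^2 is at least n B(n)^2 while the new
  variance is below (1 - n) B(n)^2. The bound on the sum improves only to the barrier at the old
  ratio, so it becomes strict one step later than the other two.\<close>

lemma trapped_next:
  assumes n: "0 < n" "n < 1" and g: "16 / pi\<^sup>2 - 1 < g"
    and rs: "0 < r" "r \<le> 1" "0 \<le> s" "g * s \<le> 1" and K: "trapped g n r s"
  shows "n < ratio (next_r r s) (next_s g r s)"
    and "next_s g r s < (1 - n) * (ellB n)\<^sup>2"
    and "barrier g (ratio r s) \<le> (next_r r s)\<^sup>2 + next_s g r s"
    and "trapped g n (next_r r s) (next_s g r s)"
proof -
  define m r' s' where "m = ratio r s" and "r' = next_r r s" and "s' = next_s g r s"
  have g0: "62/100 < g" using g threshold_bounds by simp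
  have pos: "0 < r\<^sup>2 + s" using rs by (simp add: add_pos_nonneg)
  have m: "n \<le> m" "m \<le> 1" using K ratio_bounds rs by (auto simp: trapped_def m_def)
  have nr: "0 < r'" "r'\<^sup>2 = m * (ellB m)\<^sup>2" using next_r_bounds[OF rs(1,3)] by (auto simp: r'_def m_def)
  have ns: "0 \<le> s'" using next_s_nonneg[of g s r] g0 rs by (simp add: s'_def)
  have mult: "m * (r\<^sup>2 + s) = r\<^sup>2" "(1 - m) * (r\<^sup>2 + s) = s" using ratio_mult[OF pos] by (auto simp: m_def)
  have "(sqrt (r\<^sup>2 + s))\<^sup>2 + 1 - sqrt (r\<^sup>2 + s) * ellT m < g * ((1 - n) * (ellB n)\<^sup>2)"
    using K rs n pos mult power_le_one[of r 2]
    by (intro variance_below_barrier_level n m g) (auto simp: trapped_def)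
  then have s': "s' < (1 - n) * (ellB n)\<^sup>2"
    using g0 pos by (simp add: s'_def next_s_def m_def[symmetric] field_simps)
  then show "next_s g r s < (1 - n) * (ellB n)\<^sup>2" by (simp add: s'_def)
  have "n * (ellB n)\<^sup>2 \<le> r'\<^sup>2"
    unfolding nr using m n ellB_mono[of n m] ellB_pos[of n] by (intro mult_mono power_mono) auto
  then have "n * s' < (1 - n) * r'\<^sup>2"
  proof -
    have "n * s' < n * ((1 - n) * (ellB n)\<^sup>2)" using s' n by simp
    also have "\<dots> = (1 - n) * (n * (ellB n)\<^sup>2)" by simp
    also have "\<dots> \<le> (1 - n) * r'\<^sup>2" using \<open>n * (ellB n)\<^sup>2 \<le> r'\<^sup>2\<close> n by (intro mult_left_mono) auto
    finally show ?thesis .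
  qed
  then have n': "n < ratio r' s'"
  proof -
    have "0 < r'\<^sup>2 + s'" using nr(1) ns by (simp add: add_pos_nonneg)
    then show ?thesis using \<open>n * s' < (1 - n) * r'\<^sup>2\<close> by (simp add: ratio_def pos_less_divide_eq algebra_simps)
  qed
  then show "n < ratio (next_r r s) (next_s g r s)" by (simp add: r'_def s'_def)
  have b: "barrier g m \<le> r'\<^sup>2 + s'"
    using next_s_ge[of g r s] g0 pos by (simp add: barrier_def nr(2) s'_def m_def[symmetric])
  then show "barrier g (ratio r s) \<le> (next_r r s)\<^sup>2 + next_s g r s" by (simp add: m_def r'_def s'_def)
  have "barrier g n \<le> barrier g m" using barrier_mono[of g n m] g0 n m by simp
  then show "trapped g n (next_r r s) (next_s g r s)"
    using n' s' b by (simp add: trapped_def r'_def s'_def)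
qed

text \<open>Only |\<alpha>| and the variance enter the recursion, so the phase is dropped.\<close>

locale se_orbit =
  fixes g :: real and r s :: "nat \<Rightarrow> real"
  assumes g: "16 / pi\<^sup>2 - 1 < g"
    and r0: "0 < r 0" "r 0 \<le> 1" and s0: "0 \<le> s 0" "s 0 \<le> 1"
    and r_Suc: "r (Suc t) = next_r (r t) (s t)"
    and s_Suc: "s (Suc t) = next_s g (r t) (s t)"
begin

lemma g_gt: "62/100 < g"
  using g threshold_bounds by simp

lemma orbit_bounds: "0 < r t \<and> r t \<le> 1 \<and> 0 \<le> s t"
proof (induction t)
  case (Suc t)
  then show ?case using next_r_bounds[of "r t" "s t"] next_s_nonneg[of g "s t" "r t"] g_gt by (simp add: r_Suc s_Suc)
qed (use r0 s0 in auto)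

lemma r_pos: "0 < r t" and r_le_1: "r t \<le> 1" and s_nonneg: "0 \<le> s t"
  using orbit_bounds by auto

lemma sum_pos: "0 < (r t)\<^sup>2 + s t"
  using r_pos[of t] s_nonneg[of t] by (simp add: add_pos_nonneg)

text \<open>The index starts at 1 because g may exceed 1 while the initial variance is only bounded
  by 1. At the first step l <= 3/2 <= T; afterwards \<open>less_ellT\<close> applies.\<close>

lemma s_Suc_upper: "g * s (Suc t) \<le> 1"
proof (induction t)
  case 0
  have "(r 0)\<^sup>2 + s 0 \<le> (3/2)\<^sup>2" using power_le_one[of "r 0" 2] r0 s0 by (simp add: power2_eq_square)
  then have "sqrt ((r 0)\<^sup>2 + s 0) \<le> 3/2" by (intro real_le_lsqrt) auto
  also have "\<dots> \<le> ellT (ratio (r 0) (s 0))"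
    using ellT_ge_linear[of "ratio (r 0) (s 0)"] ratio_bounds[of "s 0" "r 0"] s0 by simp
  finally show ?case using next_s_upper[of g "s 0" "r 0"] g_gt s0 by (simp add: s_Suc)
next
  case (Suc t)
  let ?r = "r (Suc t)" and ?s = "s (Suc t)"
  have "sqrt (?r\<^sup>2 + ?s) < ellT (ratio ?r ?s)"
  proof (rule less_ellT)
    have "62/100 * ?s \<le> g * ?s" using g_gt s_nonneg by (intro mult_right_mono) auto
    then show "62/100 * ((1 - ratio ?r ?s) * (sqrt (?r\<^sup>2 + ?s))\<^sup>2) \<le> 1"
      using Suc sum_pos[of "Suc t"] ratio_mult(2)[OF sum_pos[of "Suc t"]] by simp
    show "ratio ?r ?s * (sqrt (?r\<^sup>2 + ?s))\<^sup>2 \<le> 1"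
      using sum_pos[of "Suc t"] ratio_mult(1)[OF sum_pos[of "Suc t"]] r_le_1[of "Suc t"] r_pos[of "Suc t"]
      by (simp add: power_le_one)
  qed (use ratio_bounds s_nonneg[of "Suc t"] sum_pos[of "Suc t"] in auto)
  then show ?case using next_s_upper[of g ?s ?r] g_gt s_nonneg[of "Suc t"] by (simp add: s_Suc[of "Suc t"])
qed

lemma trapped_forward:
  assumes "0 < n" "n < 1" "trapped g n (r (Suc t)) (s (Suc t))"
  shows "trapped g n (r (Suc (t + k))) (s (Suc (t + k)))"
proof (induction k)
  case (Suc k)
  show ?case
    using trapped_next(4)[OF assms(1,2) g r_pos r_le_1 s_nonneg s_Suc_upper Suc]
    by (simp add: r_Suc[of "Suc (t + k)"] s_Suc[of "Suc (t + k)"])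
qed (use assms in simp)

text \<open>Above the level \<open>\<pi>\<^sup>2/16\<close> the variance decreases, and a limit point would violate the strictness.\<close>

lemma eventually_small_variance: "\<exists>t. s (Suc t) < pi\<^sup>2 / 16"
proof (rule ccontr)
  assume "\<not> ?thesis"
  then have big: "pi\<^sup>2 / 16 \<le> s (Suc t)" for t by (auto simp: not_less)
  \<comment> \<open>The case rho = 0 is included, since a limit point of |\<alpha>| might be 0 at
    this stage. The constant pi^2 / 16 is B(0)^2, the highest level of the stationary curve.\<close>
  have dec: "next_s g \<rho> \<sigma> < \<sigma>"
    if \<rho>: "0 \<le> \<rho>" "\<rho> \<le> 1" and \<sigma>: "pi\<^sup>2 / 16 \<le> \<sigma>" "g * \<sigma> \<le> 1" for \<rho> \<sigma>
  proof -
    define m l where "m = ratio \<rho> \<sigma>" and "l = sqrt (\<rho>\<^sup>2 + \<sigma>)"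
    have "0 < pi\<^sup>2 / 16" by simp
    then have \<sigma>0: "0 < \<sigma>" using \<sigma>(1) by linarith
    then have pos: "0 < \<rho>\<^sup>2 + \<sigma>" by (simp add: add_nonneg_pos)
    have l: "0 \<le> l" "l\<^sup>2 = \<rho>\<^sup>2 + \<sigma>" using pos by (auto simp: l_def)
    have ml: "m * l\<^sup>2 = \<rho>\<^sup>2" "(1 - m) * l\<^sup>2 = \<sigma>" using ratio_mult[OF pos] l by (auto simp: m_def)
    have m: "0 \<le> m" "m < 1"
      using ratio_bounds[of \<sigma> \<rho>] \<sigma>0 ml(2) by (auto simp: m_def less_le)
    have "(1 - m) * (ellB m)\<^sup>2 \<le> (ellB 0)\<^sup>2" using one_minus_ellB_sq_antimono[of 0 m] m by simp
    also have "\<dots> \<le> (1 - m) * l\<^sup>2" using \<sigma>(1) by (simp add: ml ellB_0 power_divide)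
    finally have "(ellB m)\<^sup>2 \<le> l\<^sup>2" using m by simp
    then have "ellB m \<le> l" using l(1) by (rule power2_le_imp_le)
    then have "l\<^sup>2 + 1 - l * ellT m < g * ((1 - m) * l\<^sup>2)"
      using \<rho> \<sigma>(2) by (intro variance_decreases m g) (auto simp: ml power_le_one)
    then show ?thesis using g_gt unfolding ml(2) unfolding l(2) by (simp add: next_s_def l_def m_def field_simps)
  qed
  have "decseq (\<lambda>t. s (Suc t))"
    unfolding decseq_Suc_iff
    using dec[OF less_imp_le[OF r_pos] r_le_1 big s_Suc_upper] by (simp add: s_Suc[of "Suc _"] less_imp_le)
  then obtain \<sigma> where \<sigma>: "(\<lambda>t. s (Suc t)) \<longlonglongrightarrow> \<sigma>" "\<And>t. \<sigma> \<le> s (Suc t)"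
    using decseq_convergent[of "\<lambda>t. s (Suc t)" 0] s_nonneg by auto
  have "\<forall>t. r (Suc t) \<in> {0..1}" using less_imp_le[OF r_pos] r_le_1 by auto
  from seq_compactE[OF compact_imp_seq_compact[OF compact_Icc] this]
  obtain \<rho> \<phi> where \<rho>: "\<rho> \<in> {0..1}" "strict_mono \<phi>" "((\<lambda>t. r (Suc t)) \<circ> \<phi>) \<longlonglongrightarrow> \<rho>" .
  have \<sigma>b: "pi\<^sup>2 / 16 \<le> \<sigma>" using \<sigma>(1) big by (intro LIMSEQ_le_const) auto
  have "0 < pi\<^sup>2 / 16" by simp
  then have \<sigma>0: "0 < \<sigma>" using \<sigma>b by linarith
  have "g * \<sigma> \<le> g * s (Suc 0)" using \<sigma>(2) g_gt by (intro mult_left_mono) auto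
  then have g\<sigma>: "g * \<sigma> \<le> 1" using s_Suc_upper[of 0] by simp
  have s\<phi>: "(\<lambda>k. s (Suc (\<phi> k))) \<longlonglongrightarrow> \<sigma>"
    using LIMSEQ_subseq_LIMSEQ[OF \<sigma>(1) \<rho>(2)] by (simp add: o_def)
  have r\<phi>: "(\<lambda>k. r (Suc (\<phi> k))) \<longlonglongrightarrow> \<rho>" using \<rho>(3) by (simp add: o_def)
  have "(\<lambda>k. next_s g (r (Suc (\<phi> k))) (s (Suc (\<phi> k)))) \<longlonglongrightarrow> next_s g \<rho> \<sigma>"
    using \<sigma>0 g_gt s_nonneg by (intro tendsto_next(2)[OF r\<phi> s\<phi>]) (auto simp: add_nonneg_pos)
  moreover have "next_s g (r (Suc (\<phi> k))) (s (Suc (\<phi> k))) = s (Suc (Suc (\<phi> k)))" for k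
    by (simp add: s_Suc[of "Suc _"])
  moreover have "(\<lambda>k. s (Suc (Suc (\<phi> k)))) \<longlonglongrightarrow> \<sigma>"
    using LIMSEQ_subseq_LIMSEQ[OF LIMSEQ_Suc[OF \<sigma>(1)] \<rho>(2)] by (simp add: o_def)
  ultimately have "next_s g \<rho> \<sigma> = \<sigma>" using LIMSEQ_unique by auto
  then show False using dec[of \<rho> \<sigma>] \<rho>(1) \<sigma>b g\<sigma> by auto
qed

lemma eventually_trapped: "\<exists>n t. 0 < n \<and> n < 1 \<and> trapped g n (r (Suc t)) (s (Suc t))"
proof -
  obtain t where t: "s (Suc t) < pi\<^sup>2 / 16" using eventually_small_variance by blast
  have "((\<lambda>n. (1 - n) * (ellB n)\<^sup>2) \<longlongrightarrow> (1 - 0) * (ellB 0)\<^sup>2) (at 0 within {0..1})"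
    using continuous_on_ellB by (intro tendsto_intros) (auto simp: continuous_on)
  then have "\<forall>\<^sub>F n in at 0 within {0..1}. s (Suc t) < (1 - n) * (ellB n)\<^sup>2"
    using t by (intro order_tendstoD) (auto simp: ellB_0 power_divide)
  then obtain d where d: "0 < d" "\<And>n. n \<in> {0..1} \<Longrightarrow> n \<noteq> 0 \<Longrightarrow> dist n 0 < d \<Longrightarrow> s (Suc t) < (1 - n) * (ellB n)\<^sup>2"
    unfolding eventually_at by blast
  define m0 m1 where "m0 = ratio (r t) (s t)" and "m1 = ratio (r (Suc t)) (s (Suc t))"
  have m01: "0 < m0" "m0 \<le> 1" "0 < m1"
    using ratio_pos[OF r_pos s_nonneg] ratio_bounds[OF s_nonneg] by (auto simp: m0_def m1_def)
  \<comment> \<open>d / 2 keeps the variance level at n above the current variance, m0 gives the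
    barrier bound through the preceding step, and m1 the ratio bound.\<close>
  define n where "n = min (min (d / 2) (1 / 2)) (min m0 m1)"
  have n: "0 < n" "n < 1" "n < d" "n \<le> m0" "n \<le> m1" using d m01 by (auto simp: n_def)
  have "barrier g n \<le> barrier g m0" using barrier_mono[of g n m0] g_gt n m01 by simp
  also have "\<dots> \<le> (r (Suc t))\<^sup>2 + s (Suc t)"
    using next_s_ge[of g "r t" "s t"] g_gt sum_pos[of t] next_r_bounds(3)[OF r_pos s_nonneg, of t t]
    by (simp add: barrier_def m0_def r_Suc s_Suc)
  finally have "trapped g n (r (Suc t)) (s (Suc t))"
    using d(2)[of n] n by (simp add: trapped_def m1_def)
  then show ?thesis using n by blast
qed

text \<open>One time of entry suffices: the regions are forward invariant and decrease with
  n.\<close>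

definition levels :: "real set" where
  "levels = {n. 0 < n \<and> n < 1 \<and> (\<exists>t. trapped g n (r (Suc t)) (s (Suc t)))}"

lemma trapped_below_Sup:
  assumes "0 < n" "n < Sup levels"
  shows "\<exists>t0. \<forall>t\<ge>t0. trapped g n (r t) (s t)"
proof -
  have "levels \<noteq> {}" using eventually_trapped by (auto simp: levels_def)
  then obtain p where "p \<in> levels" "n < p" using less_cSupD[OF _ assms(2)] by blast
  then obtain t where p: "p < 1" "trapped g p (r (Suc t)) (s (Suc t))" by (auto simp: levels_def)
  then have K: "trapped g n (r (Suc t)) (s (Suc t))"
    using trapped_antimono[of g n p] assms(1) \<open>n < p\<close> g_gt by auto
  have "trapped g n (r u) (s u)" if "Suc t \<le> u" for u
    using trapped_forward[OF assms(1) _ K, of "u - Suc t"] that \<open>n < p\<close> p(1) by simp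
  then show ?thesis by blast
qed

text \<open>If the supremum \<open>\<nu>\<close> were below 1, a limit point of the orbit would lie
  in the closed region at \<open>\<nu>\<close>. Two steps move it strictly inside, and by continuity
  the orbit itself then enters the region of some n above \<open>\<nu>\<close>.\<close>

lemma Sup_levels: "Sup levels = 1"
proof (rule ccontr)
  assume ne1: "Sup levels \<noteq> 1"
  define \<nu> where "\<nu> = Sup levels"
  have ne: "levels \<noteq> {}" using eventually_trapped by (auto simp: levels_def)
  have bdd: "bdd_above levels" by (rule bdd_aboveI[of _ 1]) (auto simp: levels_def)
  have "\<nu> \<le> 1" unfolding \<nu>_def by (rule cSup_least[OF ne]) (auto simp: levels_def)
  then have \<nu>1: "\<nu> < 1" using ne1 by (simp add: \<nu>_def)
  obtain p where "p \<in> levels" using ne by blast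
  then have \<nu>0: "0 < \<nu>" using cSup_upper[OF _ bdd, of p] by (auto simp: levels_def \<nu>_def)
  have cb: "continuous_on {0..1} (barrier g)" using g_gt by (intro continuous_on_barrier) auto
  have cP: "continuous_on {0..1} (\<lambda>n. (1 - n) * (ellB n)\<^sup>2)" by (intro continuous_intros continuous_on_ellB)

  have rs_in: "\<forall>t. (r (Suc t), s (Suc t)) \<in> {0..1} \<times> {0..1/g}"
    using less_imp_le[OF r_pos] r_le_1 s_nonneg s_Suc_upper g_gt
    by (auto simp: pos_le_divide_eq mult.commute)
  have "seq_compact ({0..1::real} \<times> {0..1/g})"
    by (intro compact_imp_seq_compact compact_Times compact_Icc)
  from seq_compactE[OF this rs_in] obtain x \<phi> where x: "x \<in> {0..1} \<times> {0..1/g}" "strict_mono \<phi>"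
      "((\<lambda>t. (r (Suc t), s (Suc t))) \<circ> \<phi>) \<longlonglongrightarrow> x" .
  define \<rho> \<sigma> where "\<rho> = fst x" and "\<sigma> = snd x"
  have r\<phi>: "(\<lambda>k. r (Suc (\<phi> k))) \<longlonglongrightarrow> \<rho>" and s\<phi>: "(\<lambda>k. s (Suc (\<phi> k))) \<longlonglongrightarrow> \<sigma>"
    using tendsto_fst[OF x(3)] tendsto_snd[OF x(3)] by (auto simp: o_def \<rho>_def \<sigma>_def)
  have \<rho>\<sigma>: "0 \<le> \<rho>" "\<rho> \<le> 1" "0 \<le> \<sigma>" "g * \<sigma> \<le> 1"
    using x(1) g_gt by (auto simp: \<rho>_def \<sigma>_def field_simps)

  have ev: "\<forall>\<^sub>F k in sequentially. trapped g n (r (Suc (\<phi> k))) (s (Suc (\<phi> k)))" if n: "0 < n" "n < \<nu>" for n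
  proof -
    obtain t0 where t0: "\<And>t. t0 \<le> t \<Longrightarrow> trapped g n (r t) (s t)" using trapped_below_Sup n unfolding \<nu>_def by blast
    have "trapped g n (r (Suc (\<phi> k))) (s (Suc (\<phi> k)))" if "t0 \<le> k" for k
      using t0[of "Suc (\<phi> k)"] seq_suble[OF x(2), of k] that by simp
    then show ?thesis by (auto simp: eventually_sequentially)
  qed
  have below: "barrier g n \<le> \<rho>\<^sup>2 + \<sigma> \<and> \<sigma> \<le> (1 - n) * (ellB n)\<^sup>2" if n: "0 < n" "n < \<nu>" for n
  proof
    have "(\<lambda>k. (r (Suc (\<phi> k)))\<^sup>2 + s (Suc (\<phi> k))) \<longlonglongrightarrow> \<rho>\<^sup>2 + \<sigma>" by (intro tendsto_intros r\<phi> s\<phi>)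
    then show "barrier g n \<le> \<rho>\<^sup>2 + \<sigma>"
      by (rule tendsto_lowerbound) (use ev[OF n] in \<open>auto elim: eventually_mono simp: trapped_def\<close>)
    show "\<sigma> \<le> (1 - n) * (ellB n)\<^sup>2"
      by (rule tendsto_upperbound[OF s\<phi>]) (use ev[OF n] in \<open>auto elim: eventually_mono simp: trapped_def\<close>)
  qed
  have pos: "0 < \<rho>\<^sup>2 + \<sigma>"
  proof -
    have n: "0 < \<nu> / 2" "\<nu> / 2 < \<nu>" "\<nu> / 2 < 1" using \<nu>0 \<nu>1 by auto
    have "0 < \<nu> / 2 * (ellB (\<nu> / 2))\<^sup>2" using n ellB_pos[of "\<nu> / 2"] by simp
    moreover have "(ellT (\<nu> / 2))\<^sup>2 \<le> 2\<^sup>2"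
      using ellT_le_2[of "\<nu> / 2"] ellT_ge_linear[of "\<nu> / 2"] n by (intro power_mono) auto
    ultimately have "0 < barrier g (\<nu> / 2)" using g_gt by (simp add: barrier_def add_pos_nonneg)
    then show ?thesis using below[OF n(1,2)] by linarith
  qed
  have m\<phi>: "(\<lambda>k. ratio (r (Suc (\<phi> k))) (s (Suc (\<phi> k)))) \<longlonglongrightarrow> ratio \<rho> \<sigma>"
    using pos by (intro tendsto_ratio r\<phi> s\<phi>) auto
  have below': "n \<le> ratio \<rho> \<sigma>" if n: "0 < n" "n < \<nu>" for n
    by (rule tendsto_lowerbound[OF m\<phi>]) (use ev[OF n] in \<open>auto elim: eventually_mono simp: trapped_def\<close>)

  have lim: "trapped g \<nu> \<rho> \<sigma>"
  proof -
    \<comment> \<open>The supremum need not be attained, so the conditions at \<open>\<nu>\<close>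
      are limits of those at levels below it; the offset 2 keeps these levels positive.\<close>
    define n where "n j = \<nu> * (1 - 1 / real (j + 2))" for j
    have n: "0 < n j" "n j < \<nu>" "n j \<in> {0..1}" for j
    proof -
      have "0 < 1 - 1 / real (j + 2)" "1 - 1 / real (j + 2) < 1" by (auto simp: field_simps)
      then show "0 < n j" "n j < \<nu>" using \<nu>0 by (auto simp: n_def)
      then show "n j \<in> {0..1}" using \<nu>1 by auto
    qed
    have "(\<lambda>j. 1 / real (j + 2)) \<longlonglongrightarrow> 0" by (rule LIMSEQ_ignore_initial_segment[OF lim_1_over_n])
    then have "n \<longlonglongrightarrow> \<nu> * (1 - 0)" unfolding n_def by (intro tendsto_intros)
    then have n_lim: "n \<longlonglongrightarrow> \<nu>" by simp
    have \<nu>01: "\<nu> \<in> {0..1}" using \<nu>0 \<nu>1 by simp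
    have cc: "\<forall>\<^sub>F j in sequentially. n j \<in> {0..1}" using n by simp
    have "(\<lambda>j. barrier g (n j)) \<longlonglongrightarrow> barrier g \<nu>"
      by (rule continuous_on_tendsto_compose[OF cb n_lim \<nu>01 cc])
    then have 1: "barrier g \<nu> \<le> \<rho>\<^sup>2 + \<sigma>"
      using below n by (intro LIMSEQ_le_const2) auto
    have "(\<lambda>j. (1 - n j) * (ellB (n j))\<^sup>2) \<longlonglongrightarrow> (1 - \<nu>) * (ellB \<nu>)\<^sup>2"
      by (rule continuous_on_tendsto_compose[OF cP n_lim \<nu>01 cc])
    then have 2: "\<sigma> \<le> (1 - \<nu>) * (ellB \<nu>)\<^sup>2"
      using below n by (intro LIMSEQ_le_const) auto
    have "\<nu> \<le> ratio \<rho> \<sigma>" using n_lim below' n by (intro LIMSEQ_le_const2[of n]) auto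
    with 1 2 show ?thesis by (simp add: trapped_def)
  qed
  have \<rho>0: "0 < \<rho>" using lim \<nu>0 \<rho>\<sigma>(1) by (auto simp: trapped_def ratio_def less_le)

  define \<rho>' \<sigma>' where "\<rho>' = next_r \<rho> \<sigma>" and "\<sigma>' = next_s g \<rho> \<sigma>"
  define \<rho>'' \<sigma>'' where "\<rho>'' = next_r \<rho>' \<sigma>'" and "\<sigma>'' = next_s g \<rho>' \<sigma>'"
  note st1 = trapped_next[OF \<nu>0 \<nu>1 g \<rho>0 \<rho>\<sigma>(2,3,4) lim, folded \<rho>'_def \<sigma>'_def]
  have b': "0 < \<rho>'" "\<rho>' \<le> 1" "0 \<le> \<sigma>'"
    using next_r_bounds[OF \<rho>0 \<rho>\<sigma>(3)] next_s_nonneg[of g \<sigma> \<rho>] \<rho>\<sigma> g_gt by (auto simp: \<rho>'_def \<sigma>'_def)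
  have r1: "(\<lambda>k. r (Suc (Suc (\<phi> k)))) \<longlonglongrightarrow> \<rho>'"
    unfolding r_Suc[of "Suc _"] \<rho>'_def using pos \<rho>\<sigma> s_nonneg by (intro tendsto_next(1)[OF r\<phi> s\<phi>, where g = 1]) auto
  have s1: "(\<lambda>k. s (Suc (Suc (\<phi> k)))) \<longlonglongrightarrow> \<sigma>'"
    unfolding s_Suc[of "Suc _"] \<sigma>'_def using pos \<rho>\<sigma> s_nonneg g_gt by (intro tendsto_next(2)[OF r\<phi> s\<phi>]) auto
  have g\<sigma>': "g * \<sigma>' \<le> 1"
    by (rule LIMSEQ_le_const2[OF tendsto_mult_left[OF s1]]) (use s_Suc_upper in auto)
  note st2 = trapped_next[OF \<nu>0 \<nu>1 g b' g\<sigma>' st1(4), folded \<rho>''_def \<sigma>''_def]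
  have pos': "0 < \<rho>'\<^sup>2 + \<sigma>'" using b' by (simp add: add_pos_nonneg)
  have r2: "(\<lambda>k. r (Suc (Suc (Suc (\<phi> k))))) \<longlonglongrightarrow> \<rho>''"
    unfolding r_Suc[of "Suc (Suc _)"] \<rho>''_def using pos' b' s_nonneg by (intro tendsto_next(1)[OF r1 s1, where g = 1]) auto
  have s2: "(\<lambda>k. s (Suc (Suc (Suc (\<phi> k))))) \<longlonglongrightarrow> \<sigma>''"
    unfolding s_Suc[of "Suc (Suc _)"] \<sigma>''_def using pos' b' s_nonneg g_gt by (intro tendsto_next(2)[OF r1 s1]) auto
  have b'': "0 < \<rho>''" "0 \<le> \<sigma>''"
    using next_r_bounds[OF b'(1,3)] next_s_nonneg[of g \<sigma>' \<rho>'] b' g_gt by (auto simp: \<rho>''_def \<sigma>''_def)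
  have bar: "barrier g \<nu> < \<rho>''\<^sup>2 + \<sigma>''"
  proof -
    have "barrier g \<nu> < barrier g (ratio \<rho>' \<sigma>')"
      using barrier_strict_mono[of g \<nu> "ratio \<rho>' \<sigma>'"] st1(1) g_gt \<nu>0 ratio_bounds[of \<sigma>' \<rho>'] b' by simp
    then show ?thesis using st2(3) by simp
  qed

  obtain n where n: "\<nu> < n" "n < 1" "n < ratio \<rho>'' \<sigma>''" "barrier g n < \<rho>''\<^sup>2 + \<sigma>''" "\<sigma>'' < (1 - n) * (ellB n)\<^sup>2"
  proof -
    have \<nu>in: "\<nu> \<in> {0..1}" using \<nu>0 \<nu>1 by simp
    have "\<forall>\<^sub>F n in at \<nu> within {0..1}. barrier g n < \<rho>''\<^sup>2 + \<sigma>''"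
      using cb \<nu>in bar by (intro order_tendstoD) (auto simp: continuous_on)
    moreover have "\<forall>\<^sub>F n in at \<nu> within {0..1}. \<sigma>'' < (1 - n) * (ellB n)\<^sup>2"
      by (rule order_tendstoD(1)[OF cP[unfolded continuous_on, rule_format, OF \<nu>in] st2(2)])
    ultimately have "\<forall>\<^sub>F n in at \<nu> within {0..1}. barrier g n < \<rho>''\<^sup>2 + \<sigma>'' \<and> \<sigma>'' < (1 - n) * (ellB n)\<^sup>2"
      by eventually_elim simp
    then obtain d where d: "0 < d" "\<And>n. n \<in> {0..1} \<Longrightarrow> n \<noteq> \<nu> \<Longrightarrow> dist n \<nu> < d \<Longrightarrow>
        barrier g n < \<rho>''\<^sup>2 + \<sigma>'' \<and> \<sigma>'' < (1 - n) * (ellB n)\<^sup>2"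
      unfolding eventually_at by blast
    define n where "n = min (\<nu> + d / 2) ((\<nu> + min 1 (ratio \<rho>'' \<sigma>'')) / 2)"
    have "\<nu> < n" "n < 1" "n < ratio \<rho>'' \<sigma>''" "n < \<nu> + d"
      using d(1) \<nu>1 st2(1) by (auto simp: n_def min_def)
    moreover from this have "n \<in> {0..1}" "n \<noteq> \<nu>" "dist n \<nu> < d" using \<nu>0 by (auto simp: dist_real_def)
    ultimately show ?thesis using that d(2) by blast
  qed
  have "\<forall>\<^sub>F k in sequentially. n < ratio (r (Suc (Suc (Suc (\<phi> k))))) (s (Suc (Suc (Suc (\<phi> k)))))"
    using n(3) b'' by (intro order_tendstoD(1)[OF tendsto_ratio[OF r2 s2]]) (auto simp: add_pos_nonneg less_imp_neq[symmetric])
  moreover have "\<forall>\<^sub>F k in sequentially. barrier g n < (r (Suc (Suc (Suc (\<phi> k)))))\<^sup>2 + s (Suc (Suc (Suc (\<phi> k))))"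
    using n(4) by (intro order_tendstoD(1)[of _ "\<rho>''\<^sup>2 + \<sigma>''"] tendsto_intros r2 s2)
  moreover have "\<forall>\<^sub>F k in sequentially. s (Suc (Suc (Suc (\<phi> k)))) < (1 - n) * (ellB n)\<^sup>2"
    using n(5) by (intro order_tendstoD(2)[OF s2])
  ultimately have "\<forall>\<^sub>F k in sequentially. trapped g n (r (Suc (Suc (Suc (\<phi> k))))) (s (Suc (Suc (Suc (\<phi> k)))))"
    by eventually_elim (simp add: trapped_def)
  then obtain k where "trapped g n (r (Suc (Suc (Suc (\<phi> k))))) (s (Suc (Suc (Suc (\<phi> k)))))"
    by (auto simp: eventually_sequentially)
  then have "n \<in> levels" using n(1,2) \<nu>0 by (auto simp: levels_def)
  then show False using cSup_upper[OF _ bdd, of n] n(1) by (simp add: \<nu>_def)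
qed

text \<open>Convergence of the ratio m to 1 suffices: the next |\<alpha>| is sqrt m B(m), which
  tends to B(1) = 1, and the variance is 1 - m times a bounded sum.\<close>

lemma tendsto_orbit: "r \<longlonglongrightarrow> 1" "s \<longlonglongrightarrow> 0"
proof -
  define m where "m t = ratio (r t) (s t)" for t
  have m01: "m t \<in> {0..1}" for t using ratio_bounds[OF s_nonneg] by (simp add: m_def)
  have m: "m \<longlonglongrightarrow> 1"
  proof (rule order_tendstoI)
    fix a :: real assume "a < 1"
    define n where "n = (max a 0 + 1) / 2"
    have n: "0 < n" "n < 1" "a < n" using \<open>a < 1\<close> by (auto simp: n_def max_def)
    obtain t0 where "\<And>t. t0 \<le> t \<Longrightarrow> trapped g n (r t) (s t)"
      using trapped_below_Sup[of n] n Sup_levels by auto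
    then have "\<forall>t\<ge>t0. a < m t" using n by (force simp: trapped_def m_def)
    then show "\<forall>\<^sub>F t in sequentially. a < m t" by (auto simp: eventually_sequentially)
  next
    fix a :: real assume a: "1 < a"
    have "m t < a" for t using m01[of t] a by simp
    then show "\<forall>\<^sub>F t in sequentially. m t < a" by simp
  qed
  have "(\<lambda>t. ellB (m t)) \<longlonglongrightarrow> ellB 1"
    using m01 by (intro continuous_on_tendsto_compose[OF continuous_on_ellB m]) auto
  then have "(\<lambda>t. sqrt (m t) * ellB (m t)) \<longlonglongrightarrow> sqrt 1 * ellB 1" by (intro tendsto_intros m)
  then have "(\<lambda>t. r (Suc t)) \<longlonglongrightarrow> 1" by (simp add: r_Suc next_r_def m_def ellB_1)
  then show "r \<longlonglongrightarrow> 1" by (simp only: filterlim_sequentially_Suc)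
  have "(\<lambda>t. s (Suc t)) \<longlonglongrightarrow> 0"
  proof (rule tendsto_sandwich[of "\<lambda>_. 0" _ _ "\<lambda>t. (1 - m (Suc t)) * (1 + 1 / g)"])
    show "\<forall>\<^sub>F t in sequentially. s (Suc t) \<le> (1 - m (Suc t)) * (1 + 1 / g)"
    proof (rule always_eventually, rule allI)
      fix t
      have "(r (Suc t))\<^sup>2 + s (Suc t) \<le> 1 + 1 / g"
        using s_Suc_upper[of t] power_le_one[of "r (Suc t)" 2] r_pos[of "Suc t"] r_le_1[of "Suc t"] g_gt
        by (intro add_mono) (auto simp: field_simps)
      then have "(1 - m (Suc t)) * ((r (Suc t))\<^sup>2 + s (Suc t)) \<le> (1 - m (Suc t)) * (1 + 1 / g)"
        using m01[of "Suc t"] by (intro mult_left_mono) auto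
      then show "s (Suc t) \<le> (1 - m (Suc t)) * (1 + 1 / g)"
        using ratio_mult(2)[OF sum_pos[of "Suc t"]] by (simp add: m_def)
    qed
    have "(\<lambda>t. (1 - m (Suc t)) * (1 + 1 / g)) \<longlonglongrightarrow> (1 - 1) * (1 + 1 / g)"
      by (intro tendsto_intros LIMSEQ_Suc[OF m])
    then show "(\<lambda>t. (1 - m (Suc t)) * (1 + 1 / g)) \<longlonglongrightarrow> 0" by simp
  qed (use s_nonneg in auto)
  then show "s \<longlonglongrightarrow> 0" by (simp only: filterlim_sequentially_Suc)
qed

end

theorem mainTheorem1:
  fixes \<delta> :: real and a0 :: complex and s0 :: real
  assumes "\<delta> > 64 / pi\<^sup>2 - 4"
    and "0 < cmod a0" and "cmod a0 \<le> 1"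
    and "0 \<le> s0" and "s0 \<le> 1"
  shows "(\<lambda>t. cmod (fst (SE \<delta> 0 a0 s0 t))) \<longlonglongrightarrow> 1
       \<and> (\<lambda>t. snd (SE \<delta> 0 a0 s0 t)) \<longlonglongrightarrow> 0"
proof -
  let ?a = "\<lambda>t. fst (SE \<delta> 0 a0 s0 t)" and ?s = "\<lambda>t. snd (SE \<delta> 0 a0 s0 t)"
  have g: "16 / pi\<^sup>2 - 1 < \<delta> / 4" using assms(1) by simp
  have step: "?a (Suc t) = psi1 (?a t) (?s t)" "?s (Suc t) = psi2 (?a t) (?s t) \<delta> 0" for t
    by (simp_all add: split_beta)
  \<comment> \<open>The formulas for \<open>psi1\<close> and \<open>psi2\<close> in terms of the
    ratio are stated for nonzero amplitude, so this is carried along the orbit.\<close>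
  have inv: "?a t \<noteq> 0 \<and> 0 \<le> ?s t" for t
  proof (induction t)
    case 0
    then show ?case using assms by auto
  next
    case (Suc t)
    have "0 < cmod (?a (Suc t))"
      unfolding step using Suc next_r_bounds(1)[of "cmod (?a t)" "?s t"] by (simp add: cmod_psi1)
    moreover have "0 \<le> ?s (Suc t)"
      unfolding step using Suc next_s_nonneg[of "\<delta> / 4" "?s t"] g threshold_bounds by (simp add: psi2_eq_next_s)
    ultimately show ?case by auto
  qed
  interpret se_orbit "\<delta> / 4" "\<lambda>t. cmod (?a t)" ?s
  proof
    show "cmod (?a (Suc t)) = next_r (cmod (?a t)) (?s t)" for t
      unfolding step using inv[of t] by (simp add: cmod_psi1)
    show "?s (Suc t) = next_s (\<delta> / 4) (cmod (?a t)) (?s t)" for t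
      unfolding step using inv[of t] by (simp add: psi2_eq_next_s)
  qed (use g assms in auto)
  show ?thesis using tendsto_orbit by simp
qed

end
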